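(* Let $G$ and $H$ be graphs in $\Gamma_3$. For any natural number $n$ there is a graph in $\mathcal R(G,H)$ containing a cycle of length at least $n$.
   Context: All graphs are simple and finite. A 2-coloring of the edges of a graph $F=(V_F,E_F)$ is a map $\mathbf c:E_F\to\{0,1\}$ (0 = red, 1 = blue). For fixed graphs $G,H$, such a coloring is $(G,H)$-good if there is no subgraph of $F$ isomorphic to $G$ all of whose edges are red and no subgraph isomorphic to $H$ all of whose edges are blue. One writes $F\longrightarrow(G,H)$ if $F$ has no $(G,H)$-good coloring. A graph $F$ is $(G,H)$-minimal if $F\longrightarrow(G,H)$ but no proper subgraph $F'\subset F$ satisfies $F'\longrightarrow(G,H)$. $\mathcal R(G,H)$ denotes the set of all $(G,H)$-minimal graphs. $\Gamma_3$ denotes the class consisting of all 3-connected graphs together with the triangle $K_3$. *)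

theory Defs
  imports Main "HOL-Library.FuncSet"
begin

type_synonym 'a graph = "'a set \<times> 'a set set"

abbreviation verts :: "'a graph \<Rightarrow> 'a set" where
  "verts G \<equiv> fst G"

abbreviation edges :: "'a graph \<Rightarrow> 'a set set" where
  "edges G \<equiv> snd G"

(* Edges are two-element vertex sets, so there are no loops and no multiple edges. *)
definition sgraph :: "'a graph \<Rightarrow> bool" where
  "sgraph G \<longleftrightarrow> finite (verts G) \<and> (\<forall>e\<in>edges G. e \<subseteq> verts G \<and> card e = 2)"

(* Subgraphs need not be induced. *)
definition subgraph :: "'a graph \<Rightarrow> 'a graph \<Rightarrow> bool" where
  "subgraph S F \<longleftrightarrow> sgraph S \<and> verts S \<subseteq> verts F \<and> edges S \<subseteq> edges F"

definition isomorphic :: "'a graph \<Rightarrow> 'b graph \<Rightarrow> bool" where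
  "isomorphic G H \<longleftrightarrow>
     (\<exists>f. bij_betw f (verts G) (verts H) \<and>
          (\<forall>u\<in>verts G. \<forall>v\<in>verts G. {u, v} \<in> edges G \<longleftrightarrow> {f u, f v} \<in> edges H))"

(* The colour 0 is red and the colour 1 is blue; only the values of c on edges of F matter. *)
definition good_coloring :: "'a graph \<Rightarrow> 'b graph \<Rightarrow> 'c graph \<Rightarrow> ('c set \<Rightarrow> nat) \<Rightarrow> bool" where
  "good_coloring G H F c \<longleftrightarrow>
     c \<in> edges F \<rightarrow> {0, 1} \<and>
     \<not> (\<exists>S. subgraph S F \<and> isomorphic S G \<and> (\<forall>e\<in>edges S. c e = 0)) \<and>
     \<not> (\<exists>S. subgraph S F \<and> isomorphic S H \<and> (\<forall>e\<in>edges S. c e = 1))"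

definition ramsey_arrow :: "'c graph \<Rightarrow> 'a graph \<Rightarrow> 'b graph \<Rightarrow> bool" where
  "ramsey_arrow F G H \<longleftrightarrow> \<not> (\<exists>c. good_coloring G H F c)"

definition ramsey_minimal :: "'a graph \<Rightarrow> 'b graph \<Rightarrow> 'c graph set" where
  "ramsey_minimal G H =
     {F. sgraph F \<and> ramsey_arrow F G H \<and>
         (\<forall>F'. subgraph F' F \<and> F' \<noteq> F \<longrightarrow> \<not> ramsey_arrow F' G H)}"

definition connected_graph :: "'a graph \<Rightarrow> bool" where
  "connected_graph G \<longleftrightarrow>
     verts G \<noteq> {} \<and>
     (\<forall>u\<in>verts G. \<forall>v\<in>verts G. (u, v) \<in> {(x, y). {x, y} \<in> edges G}\<^sup>*)"

definition delete_verts :: "'a graph \<Rightarrow> 'a set \<Rightarrow> 'a graph" where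
  "delete_verts G X = (verts G - X, {e \<in> edges G. e \<inter> X = {}})"

(* The bound on the number of vertices excludes the complete graph on k vertices;
   in particular the triangle is not 3-connected. *)
definition k_connected :: "nat \<Rightarrow> 'a graph \<Rightarrow> bool" where
  "k_connected k G \<longleftrightarrow>
     card (verts G) > k \<and>
     (\<forall>X. X \<subseteq> verts G \<and> card X < k \<longrightarrow> connected_graph (delete_verts G X))"

definition triangle :: "'a graph \<Rightarrow> bool" where
  "triangle G \<longleftrightarrow> card (verts G) = 3 \<and> edges G = {e. e \<subseteq> verts G \<and> card e = 2}"

definition Gamma3 :: "'a graph set" where
  "Gamma3 = {G. sgraph G \<and> (k_connected 3 G \<or> triangle G)}"

(* A cycle is the list of its vertices in cyclic order; its length is the length of the list. *)
definition is_cycle :: "'a graph \<Rightarrow> 'a list \<Rightarrow> bool" where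
  "is_cycle F p \<longleftrightarrow>
     length p \<ge> 3 \<and> distinct p \<and> set p \<subseteq> verts F \<and>
     (\<forall>i<length p. {p ! i, p ! (Suc i mod length p)} \<in> edges F)"

end

(* Remove an edge vx from a minimal arrowing graph. In a good colouring of the rest the star at x
   is never monochromatic: every vertex of G and H has degree at least two, so otherwise vx could be
   coloured with the colour missing at x. If in such a graph no single edge has a forced colour,
   take copies that all share the vertex x and glue the remaining ends of their stars along a
   uniform hypergraph that is not 2-colourable and whose small parts are forests. The result arrows
   (G, H). Conversely, a subgraph without long cycles falls apart into pieces of single copies by
   repeated splitting along x and one further vertex; since G and H stay connected after removing
   two vertices, good colourings of the pieces combine, and the subgraph does not arrow. So every
   minimal arrowing subgraph has a long cycle.

   If some edge does have a forced colour, gluing such graphs on all edges but one of G, or of H,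
   forces the other colour as well, and a gadget with the same properties is built from G and H with
   all but two adjacent edges forced. *)

theory Submission
  imports "HOL-Library.Ramsey" "HOL-Library.Nat_Bijection" Defs
begin

section \<open>Good colourings of edge sets\<close>

text \<open>Copies sharing \<open>x\<close> may have short cycles through \<open>x\<close>, so
  sparseness only controls cycles that avoid \<open>x\<close>. Such a cycle runs through a cyclic
  sequence of hyperedges, and a hyperedge that is a leaf among them would be entered and left at the
  same vertex, which a cycle cannot do. So away from \<open>x\<close> the copies in a subgraph
  without long cycles hang together like a tree, and \<open>x\<close> together with one shared
  vertex is a cut. The obstacle is that the two vertices of a cut can be adjacent: their edge lies
  on both sides and needs the same colour in both colourings. Hence the insistence on gadgets in
  which each spoke \<open>{x, l}\<close> takes both colours, and hence forced colours need a
  construction of their own. It is enough that each spoke alone is free, with the others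
  uncontrolled, because only one spoke is matched at a time. All spokes glued at one vertex of the
  hypergraph become a single edge, whose colour serves as the colour of that vertex; this is where
  the hypergraph has to defeat every 2-colouring.\<close>

text \<open>The bound 3 on the number of vertices, one less than in 3-connectedness, admits the triangle.\<close>

definition conn3 :: "'a graph \<Rightarrow> bool" where
  "conn3 G \<longleftrightarrow> sgraph G \<and> card (verts G) \<ge> 3 \<and>
     (\<forall>X. X \<subseteq> verts G \<and> card X < 3 \<longrightarrow> connected_graph (delete_verts G X))"

lemma conn3_if_Gamma3:
  assumes "G \<in> Gamma3"
  shows "conn3 G"
proof -
  have sg: "sgraph G" and or: "k_connected 3 G \<or> triangle G"
    using assms by (auto simp: Gamma3_def)
  show ?thesis
  proof (cases "triangle G")
    case False
    then show ?thesis using sg or by (auto simp: conn3_def k_connected_def)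
  next
    case True
    then have c3: "card (verts G) = 3" and ed: "edges G = {e. e \<subseteq> verts G \<and> card e = 2}"
      by (auto simp: triangle_def)
    have "connected_graph (delete_verts G X)" if X: "X \<subseteq> verts G" "card X < 3" for X
    proof -
      have "verts G - X \<noteq> {}"
        using X c3 by (metis Diff_eq_empty_iff less_irrefl subset_antisym)
      moreover have "(u, v) \<in> {(x, y). {x, y} \<in> {e \<in> edges G. e \<inter> X = {}}}\<^sup>*"
        if "u \<in> verts G - X" "v \<in> verts G - X" for u v
      proof (cases "u = v")
        case False
        then have "{u, v} \<in> edges G" "{u, v} \<inter> X = {}"
          using that by (auto simp: ed)
        then show ?thesis by (intro r_into_rtrancl) auto
      qed simp
      ultimately show ?thesis
        by (simp add: connected_graph_def delete_verts_def)
    qed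
    then show ?thesis using sg c3 by (simp add: conn3_def)
  qed
qed

lemma conn3_edge: "conn3 G \<Longrightarrow> e \<in> edges G \<Longrightarrow> e \<subseteq> verts G \<and> card e = 2"
  by (auto simp: conn3_def sgraph_def)

lemma conn3_finite: "conn3 G \<Longrightarrow> finite (verts G) \<and> finite (edges G)"
proof -
  assume "conn3 G"
  then have "finite (verts G)" "edges G \<subseteq> Pow (verts G)"
    by (auto simp: conn3_def sgraph_def)
  then show ?thesis by (meson finite_Pow_iff finite_subset)
qed

lemma conn3_path:
  assumes "conn3 G" "X \<subseteq> verts G" "card X < 3" "p \<in> verts G - X" "q \<in> verts G - X"
  shows "(p, q) \<in> {(x, y). {x, y} \<in> edges G \<and> x \<notin> X \<and> y \<notin> X}\<^sup>*"
proof -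
  have "connected_graph (delete_verts G X)" using assms by (auto simp: conn3_def)
  then have "(p, q) \<in> {(x, y). {x, y} \<in> {e \<in> edges G. e \<inter> X = {}}}\<^sup>*"
    using assms(4,5) by (simp add: connected_graph_def delete_verts_def)
  moreover have "{(x, y). {x, y} \<in> {e \<in> edges G. e \<inter> X = {}}} =
      {(x, y). {x, y} \<in> edges G \<and> x \<notin> X \<and> y \<notin> X}"
    by auto
  ultimately show ?thesis by simp
qed

lemma conn3_neighbour:
  assumes G: "conn3 G" and p: "p \<in> verts G" "p \<noteq> q"
  obtains r where "r \<noteq> q" "r \<noteq> p" "{p, r} \<in> edges G"
proof -
  \<comment> \<open>\<open>q\<close> may lie outside \<open>G\<close>, while
    \<open>conn3_path\<close> deletes only vertices of \<open>G\<close>.\<close>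
  let ?X = "{q} \<inter> verts G"
  have "card {p, q} \<le> 2" by (simp add: card_insert_if)
  then have "\<not> verts G \<subseteq> {p, q}"
    using G card_mono[of "{p, q}" "verts G"] by (fastforce simp: conn3_def)
  then obtain s where s: "s \<in> verts G" "s \<noteq> p" "s \<noteq> q" by auto
  have "card ?X < 3"
    using card_mono[of "{q}" ?X] by simp
  then have "(p, s) \<in> {(x, y). {x, y} \<in> edges G \<and> x \<notin> ?X \<and> y \<notin> ?X}\<^sup>*"
    using conn3_path[OF G, of ?X p s] p s by auto
  then obtain r where "{p, r} \<in> edges G" "r \<notin> ?X"
    using s by (auto elim: converse_rtranclE)
  moreover then have "r \<in> verts G" "r \<noteq> p" using conn3_edge[OF G] by force+
  ultimately show ?thesis using that by auto
qed

lemma conn3_two_neighbours: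
  assumes G: "conn3 G" and p: "p \<in> verts G"
  obtains q r where "q \<noteq> r" "{p, q} \<in> edges G" "{p, r} \<in> edges G"
proof -
  have "verts G \<noteq> {p}" using G by (auto simp: conn3_def)
  then obtain s where "s \<noteq> p" using p by auto
  then obtain q where q: "{p, q} \<in> edges G" "q \<noteq> p" by (metis conn3_neighbour[OF G p])
  then obtain r where "r \<noteq> q" "{p, r} \<in> edges G" by (metis conn3_neighbour[OF G p])
  then show ?thesis using q that by metis
qed

section \<open>Copies of a graph inside an edge set\<close>

definition emb :: "'a graph \<Rightarrow> 'v set set \<Rightarrow> bool" where
  "emb G R \<longleftrightarrow> (\<exists>f. inj_on f (verts G) \<and> (\<forall>e\<in>edges G. f ` e \<in> R))"

lemma emb_mono: "emb G R \<Longrightarrow> R \<subseteq> R' \<Longrightarrow> emb G R'"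
  unfolding emb_def by blast

lemma emb_inj_image:
  assumes G: "conn3 G" and \<phi>: "inj \<phi>"
  shows "emb G ((`) \<phi> ` R) \<longleftrightarrow> emb G R"
proof
  assume "emb G R"
  then obtain f where "inj_on f (verts G)" "\<forall>e\<in>edges G. f ` e \<in> R" by (auto simp: emb_def)
  then have "inj_on (\<phi> \<circ> f) (verts G)" "\<forall>e\<in>edges G. (\<phi> \<circ> f) ` e \<in> (`) \<phi> ` R"
    using \<phi> by (auto simp: image_comp[symmetric] intro: comp_inj_on inj_on_subset)
  then show "emb G ((`) \<phi> ` R)" unfolding emb_def by blast
next
  assume "emb G ((`) \<phi> ` R)"
  then obtain f where f: "inj_on f (verts G)" "\<forall>e\<in>edges G. f ` e \<in> (`) \<phi> ` R"
    by (auto simp: emb_def)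
  \<comment> \<open>Every vertex of \<open>G\<close> lies on an edge, so all of \<open>f\<close>
    lands in \<open>range \<phi>\<close> and can be pulled back.\<close>
  have "f p \<in> range \<phi>" if p: "p \<in> verts G" for p
  proof -
    obtain q where "{p, q} \<in> edges G" using conn3_two_neighbours[OF G p] by metis
    with f(2) have "f ` {p, q} \<in> (`) \<phi> ` R" by (rule bspec)
    then show ?thesis by auto
  qed
  then have "inj_on (inv \<phi> \<circ> f) (verts G)"
    using f(1) by (auto simp: inj_on_def dest: inv_into_injective)
  moreover have "(inv \<phi> \<circ> f) ` e \<in> R" if e: "e \<in> edges G" for e
  proof -
    obtain r where "r \<in> R" "f ` e = \<phi> ` r" using bspec[OF f(2) e] by auto
    moreover have "(inv \<phi> \<circ> f) ` e = inv \<phi> ` f ` e" by (simp add: image_comp)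
    ultimately show ?thesis using \<phi> by (simp add: image_inv_f_f)
  qed
  ultimately show "emb G R" unfolding emb_def by blast
qed

lemma emb_card_le:
  assumes G: "conn3 G" and "emb G R" "finite R"
  shows "card (edges G) \<le> card R"
proof -
  obtain f where f: "inj_on f (verts G)" "\<forall>e\<in>edges G. f ` e \<in> R"
    using assms by (auto simp: emb_def)
  have "inj_on ((`) f) (edges G)"
    using inj_on_image_eq_iff[OF f(1)] conn3_edge[OF G] by (intro inj_onI) auto
  then show ?thesis using f(2) assms(3) by (meson card_inj_on_le image_subsetI)
qed

text \<open>The three edges form a path through \<open>r\<close>, \<open>p\<close>,
  \<open>q\<close>, \<open>s\<close>, which closes up to a triangle if \<open>s = r\<close>. The
  constant allows a colour class of at most two edges to be ignored when nearly all edges of a copy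
  have the other colour.\<close>

lemma conn3_card_edges:
  assumes G: "conn3 G"
  shows "3 \<le> card (edges G)"
proof -
  obtain p where p: "p \<in> verts G" using G by (force simp: conn3_def)
  obtain q r where qr: "q \<noteq> r" "{p, q} \<in> edges G" "{p, r} \<in> edges G"
    using conn3_two_neighbours[OF G p] .
  have pq: "p \<noteq> q" "p \<noteq> r" "q \<in> verts G" using qr conn3_edge[OF G] by force+
  obtain s where s: "s \<noteq> p" "{q, s} \<in> edges G" using conn3_neighbour[OF G pq(3), of p] pq by metis
  have "card {{p, q}, {p, r}, {q, s}} = 3"
    using qr pq s by (auto simp: card_insert_if doubleton_eq_iff)
  moreover have "{{p, q}, {p, r}, {q, s}} \<subseteq> edges G" using qr s by auto
  ultimately show ?thesis using conn3_finite[OF G] by (metis card_mono)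
qed

lemma conn3_not_emb_small:
  assumes "conn3 G" "finite R" "card R < 3"
  shows "\<not> emb G R"
  using emb_card_le[OF assms(1)] conn3_card_edges[OF assms(1)] assms by force

text \<open>A copy that fits on neither side has a vertex off the cut on each side. At most two
  vertices of \<open>G\<close> are mapped into \<open>{u, v}\<close>, so the rest of
  \<open>G\<close> is connected, and a path between the two sides would need an edge lying in
  neither \<open>A\<close> nor \<open>B\<close>. Only the edge \<open>{u, v}\<close> has no vertex
  off the cut; therefore it has to be on both sides or on neither.\<close>

lemma emb_separation:
  assumes G: "conn3 G" and em: "emb G (A \<union> B)"
    and sep: "\<Union>A \<inter> \<Union>B \<subseteq> {u, v}" and uv: "{u, v} \<in> A \<longleftrightarrow> {u, v} \<in> B"
  shows "emb G A \<or> emb G B"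
proof (rule ccontr)
  assume neg: "\<not> ?thesis"
  obtain f where f: "inj_on f (verts G)" "\<forall>e\<in>edges G. f ` e \<in> A \<union> B"
    using em by (auto simp: emb_def)
  have "\<not> (\<forall>e\<in>edges G. f ` e \<in> A)" "\<not> (\<forall>e\<in>edges G. f ` e \<in> B)"
    using neg f(1) by (auto simp: emb_def)
  then obtain e1 e2 where e1: "e1 \<in> edges G" "f ` e1 \<notin> A" and e2: "e2 \<in> edges G" "f ` e2 \<notin> B"
    by blast
  let ?X = "{p \<in> verts G. f p \<in> {u, v}}"
  have "card ?X = card (f ` ?X)"
    using f(1) by (metis (no_types, lifting) card_image inj_on_subset mem_Collect_eq subsetI)
  also have "\<dots> \<le> card {u, v}" by (intro card_mono) auto
  also have "\<dots> < 3" by (simp add: card_insert_if)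
  finally have X: "?X \<subseteq> verts G" "card ?X < 3" by auto
  have out: "\<exists>p\<in>e. f p \<notin> {u, v}" if "e \<in> edges G" "f ` e \<noteq> {u, v}" for e
  proof (rule ccontr)
    assume "\<not> ?thesis"
    then have "f ` e \<subseteq> {u, v}" by auto
    moreover have "card (f ` e) = 2"
      using f(1) conn3_edge[OF G that(1)] by (metis card_image inj_on_subset)
    ultimately show False using that(2) by (auto simp: card_2_iff)
  qed
  have "f ` e1 \<in> B" "f ` e2 \<in> A" using e1 e2 f(2) by auto
  moreover have "f ` e1 \<noteq> {u, v}" "f ` e2 \<noteq> {u, v}" using calculation e1 e2 uv by auto
  moreover obtain p1 where p1: "p1 \<in> e1" "f p1 \<notin> {u, v}"
    using out[OF e1(1)] calculation by blast
  moreover obtain p2 where p2: "p2 \<in> e2" "f p2 \<notin> {u, v}"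
    using out[OF e2(1)] calculation by blast
  ultimately have p1B: "f p1 \<in> \<Union>B" and p2A: "f p2 \<in> \<Union>A" by auto
  have "(p2, p1) \<in> {(x, y). {x, y} \<in> edges G \<and> x \<notin> ?X \<and> y \<notin> ?X}\<^sup>*"
    using p1 p2 e1 e2 conn3_edge[OF G] by (intro conn3_path[OF G X]) auto
  \<comment> \<open>A vertex of the path lying in \<open>\<Union>A\<close> and off the cut is not in
    \<open>\<Union>B\<close>, so the next edge is in \<open>A\<close> again.\<close>
  then have "f p1 \<in> \<Union>A"
  proof (induction rule: rtrancl_induct)
    case base
    show ?case using p2A by simp
  next
    case (step y z)
    then have e: "{y, z} \<in> edges G" "f y \<notin> {u, v}" using conn3_edge[OF G] by blast+
    then have "f ` {y, z} \<notin> B" using step.IH sep by blast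
    then have "f ` {y, z} \<in> A" using e f(2) by blast
    then show ?case by auto
  qed
  then show False using p1 p1B sep by blast
qed

text \<open>\<open>E\<close> is the edge set, \<open>R\<close> its red part. Isolated vertices play no role since \<open>G\<close> and \<open>H\<close> have none.\<close>

definition good :: "'a graph \<Rightarrow> 'b graph \<Rightarrow> 'v set set \<Rightarrow> 'v set set \<Rightarrow> bool" where
  "good G H E R \<longleftrightarrow> R \<subseteq> E \<and> \<not> emb G R \<and> \<not> emb H (E - R)"

definition simple_edges :: "'v set set \<Rightarrow> bool" where
  "simple_edges E \<longleftrightarrow> finite E \<and> (\<forall>e\<in>E. card e = 2)"

lemma simple_edges_Un: "simple_edges A \<Longrightarrow> simple_edges B \<Longrightarrow> simple_edges (A \<union> B)"
  by (auto simp: simple_edges_def)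

lemma simple_edges_subset: "simple_edges A \<Longrightarrow> B \<subseteq> A \<Longrightarrow> simple_edges B"
  by (auto simp: simple_edges_def intro: finite_subset)

lemma simple_edges_image: "simple_edges A \<Longrightarrow> inj \<phi> \<Longrightarrow> simple_edges ((`) \<phi> ` A)"
  by (auto simp: simple_edges_def card_image inj_on_subset)

lemma simple_edges_finite_Union: "simple_edges A \<Longrightarrow> finite (\<Union>A)"
  unfolding simple_edges_def by (metis card.infinite finite_Union zero_neq_numeral)

lemma simple_edges_loop: "simple_edges A \<Longrightarrow> {u} \<notin> A"
  by (auto simp: simple_edges_def)

lemma good_swap: "R \<subseteq> E \<Longrightarrow> good H G E (E - R) \<longleftrightarrow> good G H E R"
  by (auto simp: good_def double_diff)

lemma good_restrict:
  assumes "good G H E R" "E' \<subseteq> E"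
  shows "good G H E' (R \<inter> E')"
  using assms emb_mono[of G "R \<inter> E'" R] emb_mono[of H "E' - R \<inter> E'" "E - R"]
  by (auto simp: good_def)

lemma good_inj_image:
  assumes "conn3 G" "conn3 H" "inj \<phi>" "R \<subseteq> E"
  shows "good G H ((`) \<phi> ` E) ((`) \<phi> ` R) \<longleftrightarrow> good G H E R"
proof -
  have "(`) \<phi> ` E - (`) \<phi> ` R = (`) \<phi> ` (E - R)"
    using assms(3) by (simp add: image_set_diff inj_image_eq_iff inj_def)
  moreover have "(`) \<phi> ` R \<subseteq> (`) \<phi> ` E" using assms by auto
  ultimately show ?thesis using assms by (simp add: good_def emb_inj_image)
qed

lemma good_pullback:
  assumes "conn3 G" "conn3 H" "inj \<phi>" "good G H ((`) \<phi> ` E) R"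
  shows "good G H E {e \<in> E. \<phi> ` e \<in> R}"
proof -
  have "R = (`) \<phi> ` {e \<in> E. \<phi> ` e \<in> R}" using assms(4) by (auto simp: good_def)
  then show ?thesis using assms good_inj_image[OF assms(1-3), of "{e \<in> E. \<phi> ` e \<in> R}" E] by auto
qed

text \<open>The sides share at most the edge \<open>{u, v}\<close>, where the colourings agree, so
  the union restricts to both; \<open>emb_separation\<close> is then applied to the red and to the
  blue class. The case \<open>u = v\<close> is gluing at a single vertex, where the conditions on
  the common edge are void because there are no loops.\<close>

lemma good_glue:
  assumes G: "conn3 G" and H: "conn3 H"
    and gA: "good G H A RA" and gB: "good G H B RB"
    and simple: "simple_edges A" "simple_edges B"
    and sep: "\<Union>A \<inter> \<Union>B \<subseteq> {u, v}"
    and uv: "{u, v} \<in> A \<Longrightarrow> {u, v} \<in> B \<and> ({u, v} \<in> RA \<longleftrightarrow> {u, v} \<in> RB)"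
      "{u, v} \<in> B \<Longrightarrow> {u, v} \<in> A"
  shows "good G H (A \<union> B) (RA \<union> RB)" "(RA \<union> RB) \<inter> A = RA" "(RA \<union> RB) \<inter> B = RB"
proof -
  have sub: "RA \<subseteq> A" "RB \<subseteq> B" using gA gB by (auto simp: good_def)
  have AB: "e = {u, v}" if "e \<in> A" "e \<in> B" for e
  proof -
    have "e \<subseteq> {u, v}" "card e = 2" using that sep simple by (auto simp: simple_edges_def)
    then show ?thesis by (auto simp: card_2_iff)
  qed
  have cons: "e \<in> RA \<longleftrightarrow> e \<in> RB" if "e \<in> A" "e \<in> B" for e
    using AB[OF that] uv that by auto
  show "(RA \<union> RB) \<inter> A = RA" "(RA \<union> RB) \<inter> B = RB" using sub cons by auto
  have eq: "A \<union> B - (RA \<union> RB) = (A - RA) \<union> (B - RB)" using sub cons by auto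
  have "\<not> emb G (RA \<union> RB)"
  proof
    assume "emb G (RA \<union> RB)"
    then have "emb G RA \<or> emb G RB"
      using sub sep uv by (intro emb_separation[OF G, of _ _ u v]) blast+
    then show False using gA gB by (auto simp: good_def)
  qed
  moreover have "\<not> emb H ((A - RA) \<union> (B - RB))"
  proof
    assume "emb H ((A - RA) \<union> (B - RB))"
    then have "emb H (A - RA) \<or> emb H (B - RB)"
      using sub sep uv by (intro emb_separation[OF H, of _ _ u v]) blast+
    then show False using gA gB by (auto simp: good_def)
  qed
  ultimately show "good G H (A \<union> B) (RA \<union> RB)" using sub eq by (auto simp: good_def)
qed

section \<open>Sparse hypergraphs that are not 2-colourable\<close>

definition uniform :: "nat \<Rightarrow> 'v set set \<Rightarrow> bool" where
  "uniform k E \<longleftrightarrow> finite E \<and> (\<forall>e\<in>E. finite e \<and> card e = k)"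

definition monochromatic :: "('v \<Rightarrow> bool) \<Rightarrow> 'v set \<Rightarrow> bool" where
  "monochromatic c e \<longleftrightarrow> (\<exists>b. \<forall>v\<in>e. c v = b)"

text \<open>An edge disjoint from all others counts as a leaf too, as \<open>z\<close> may lie
  outside \<open>e\<close>.\<close>

definition leaf :: "'v set set \<Rightarrow> 'v set \<Rightarrow> bool" where
  "leaf E e \<longleftrightarrow> (\<exists>z. e \<inter> \<Union>(E - {e}) \<subseteq> {z})"

text \<open>Asking for two leaves instead of one makes the property survive the amalgamation below, where
  a leaf may be lost at the vertex that attaches its copy to the other copies.\<close>

definition locally_forest :: "nat \<Rightarrow> 'v set set \<Rightarrow> bool" where
  "locally_forest g E \<longleftrightarrow> (\<forall>E'\<subseteq>E. 2 \<le> card E' \<and> card E' \<le> g \<longrightarrow>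
     (\<exists>e1\<in>E'. \<exists>e2\<in>E'. e1 \<noteq> e2 \<and> leaf E' e1 \<and> leaf E' e2))"

lemma card_inj_image: "inj f \<Longrightarrow> card (f ` A) = card A"
  by (meson card_image inj_on_subset subset_UNIV)

lemma locally_forestD:
  assumes "locally_forest g E" "E' \<subseteq> E" "2 \<le> card E'" "card E' \<le> g"
  obtains e1 e2 where "e1 \<in> E'" "e2 \<in> E'" "e1 \<noteq> e2" "leaf E' e1" "leaf E' e2"
  using assms unfolding locally_forest_def by blast

lemma two_elements:
  assumes "2 \<le> card E"
  obtains a b where "a \<in> E" "b \<in> E" "a \<noteq> b"
proof -
  have "finite E" using assms by (metis card.infinite not_numeral_le_zero)
  then have "\<not> (\<forall>a\<in>E. \<forall>b\<in>E. a = b)" using assms by (auto simp: card_le_Suc0_iff_eq[symmetric])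
  then show ?thesis using that by blast
qed

lemma two_colour_pigeonhole:
  fixes c :: "nat \<Rightarrow> bool"
  obtains S b where "S \<subseteq> {..<2 * k}" "card S = k" "\<forall>i\<in>S. c i = b"
proof -
  let ?A = "\<lambda>b. {i\<in>{..<2 * k}. c i = b}"
  have "card (?A True) + card (?A False) = card (?A True \<union> ?A False)"
    by (rule card_Un_disjoint[symmetric]) auto
  also have "?A True \<union> ?A False = {..<2 * k}" by auto
  also have "card {..<2 * k} = 2 * k" by simp
  finally have "k \<le> card (?A True) \<or> k \<le> card (?A False)" by linarith
  then obtain b where "k \<le> card (?A b)" by blast
  then obtain S where "S \<subseteq> ?A b" "card S = k" by (rule obtain_subset_with_card_n)
  then show ?thesis using that[of S b] by auto
qed

text \<open>The copies are coded by numbers. Even numbers are the shared vertices, that is, the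
  vertices of the hypergraph; odd numbers are private vertices, tagged by the number
  \<open>\<iota> h\<close> of their copy. Copy \<open>h\<close> places \<open>L\<close> on its
  hyperedge by a bijection \<open>\<beta> h\<close>.\<close>

lemma gluing_maps:
  fixes H :: "nat set set" and L :: "nat set"
  assumes H: "uniform (card L) H" and L: "finite L"
  obtains \<epsilon> :: "nat \<Rightarrow> nat" and \<phi> :: "nat set \<Rightarrow> nat \<Rightarrow> nat"
  where "inj \<epsilon>" "\<And>h. h \<in> H \<Longrightarrow> inj (\<phi> h)" "\<And>h. h \<in> H \<Longrightarrow> \<phi> h ` L = \<epsilon> ` h"
    "\<And>h h' v v'. h \<in> H \<Longrightarrow> h' \<in> H \<Longrightarrow> h \<noteq> h' \<Longrightarrow> \<phi> h v = \<phi> h' v' \<Longrightarrow> v \<in> L \<and> v' \<in> L"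
    "\<And>h v. h \<in> H \<Longrightarrow> \<phi> h v \<in> range \<epsilon> \<Longrightarrow> v \<in> L"
proof -
  have "\<exists>\<beta>. bij_betw \<beta> L h" if "h \<in> H" for h
    using that H L by (intro finite_same_card_bij) (auto simp: uniform_def)
  then obtain \<beta> where \<beta>: "\<And>h. h \<in> H \<Longrightarrow> bij_betw (\<beta> h) L h" by metis
  obtain \<iota> :: "nat set \<Rightarrow> nat" where \<iota>: "inj_on \<iota> H"
    using H finite_imp_inj_to_nat_seg by (metis uniform_def)
  define \<phi> where "\<phi> = (\<lambda>h v. if v \<in> L then 2 * \<beta> h v else 2 * prod_encode (\<iota> h, v) + 1)"
  have odd: "2 * m \<noteq> Suc (2 * l)" "Suc (2 * l) \<noteq> 2 * m" for m l :: nat by presburger+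
  show ?thesis
  proof (rule that[of "\<lambda>n. 2 * n" \<phi>])
    show "inj (\<lambda>n. 2 * n :: nat)" by (simp add: inj_def)
  next
    fix h assume h: "h \<in> H"
    show "inj (\<phi> h)"
      using \<beta>[OF h] by (auto simp: inj_def \<phi>_def bij_betw_def odd dest: inj_onD)
    have "\<phi> h ` L = (\<lambda>n. 2 * n) ` \<beta> h ` L" by (auto simp: \<phi>_def)
    then show "\<phi> h ` L = (\<lambda>n. 2 * n) ` h" using \<beta>[OF h] by (simp add: bij_betw_def)
  next
    fix h h' v v' assume "h \<in> H" "h' \<in> H" "h \<noteq> h'" "\<phi> h v = \<phi> h' v'"
    then show "v \<in> L \<and> v' \<in> L"
      using \<iota> by (auto simp: \<phi>_def odd inj_on_eq_iff split: if_splits)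
  next
    fix h v assume "\<phi> h v \<in> range (\<lambda>n. 2 * n)"
    then show "v \<in> L" by (auto simp: \<phi>_def odd split: if_splits)
  qed
qed

text \<open>The Nesetril-Rodl construction: start with a multipartite hypergraph that has a monochromatic edge
  whenever every part is monochromatic, and remove the assumption part by part. The assumption on
  part \<open>j\<close> is removed by gluing copies along part \<open>j\<close> following a hypergraph with smaller \<open>g\<close> whose
  uniformity is the size of that part.\<close>

definition partial_mono :: "nat \<Rightarrow> (nat \<Rightarrow> nat) \<Rightarrow> nat set set \<Rightarrow> bool" where
  "partial_mono j part P \<longleftrightarrow> (\<forall>c.
     (\<forall>u\<in>\<Union>P. \<forall>v\<in>\<Union>P. part u = part v \<and> j \<le> part u \<longrightarrow> c u = c v) \<longrightarrow>
     (\<exists>e\<in>P. monochromatic c e))"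

lemma partial_monoD:
  assumes "partial_mono j part P"
    and "\<And>u v. u \<in> \<Union>P \<Longrightarrow> v \<in> \<Union>P \<Longrightarrow> part u = part v \<Longrightarrow> j \<le> part u \<Longrightarrow> c u = c v"
  shows "\<exists>e\<in>P. monochromatic c e"
  using assms(1) unfolding partial_mono_def by (elim allE[of _ c] mp) (use assms(2) in blast)

text \<open>There is one edge for each choice of \<open>k\<close> out of \<open>2 * k\<close> parts,
  and the edges are pairwise disjoint. Thus every edge is a leaf, and if the parts are
  monochromatic, \<open>k\<close> of them share a colour by pigeonhole and carry a monochromatic
  edge.\<close>

lemma partite_start:
  assumes "1 \<le> k"
  obtains P part where "uniform k P" "\<forall>e\<in>P. inj_on part e \<and> part ` e \<subseteq> {..<2 * k}"
    "locally_forest g P" "partial_mono 0 part P"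
proof -
  let ?S = "{S. S \<subseteq> {..<2 * k} \<and> card S = k}"
  have "finite ?S" by simp
  then obtain \<iota> :: "nat set \<Rightarrow> nat" where \<iota>: "inj_on \<iota> ?S"
    by (metis finite_imp_inj_to_nat_seg)
  define f where "f = (\<lambda>S i. prod_encode (\<iota> S, i))"
  define part where "part = (\<lambda>v. snd (prod_decode v))"
  have part: "part (f S i) = i" for S i by (simp add: part_def f_def)
  have f_inj: "inj (f S)" for S by (metis injI part)
  define P where "P = (\<lambda>S. f S ` S) ` ?S"
  have disj: "f S ` S \<inter> f T ` T = {}" if "S \<in> ?S" "T \<in> ?S" "S \<noteq> T" for S T
    using inj_onD[OF \<iota> _ that(1,2)] that(3) by (auto simp: f_def)
  have "leaf E e" if "E \<subseteq> P" "e \<in> E" for E e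
  proof -
    have "e \<inter> e' = {}" if "e' \<in> E - {e}" for e'
    proof -
      have "e \<in> P" "e' \<in> P" "e \<noteq> e'" using \<open>E \<subseteq> P\<close> \<open>e \<in> E\<close> that by auto
      then obtain S T where ST: "e = f S ` S" "e' = f T ` T" "S \<in> ?S" "T \<in> ?S"
        unfolding P_def by (elim imageE)
      moreover have "S \<noteq> T" using ST \<open>e \<noteq> e'\<close> by blast
      ultimately show ?thesis using disj[of S T] by simp
    qed
    then have "e \<inter> \<Union>(E - {e}) = {}" by blast
    then show ?thesis by (auto simp: leaf_def)
  qed
  then have forest: "locally_forest g P"
    unfolding locally_forest_def
  proof (intro allI impI, elim conjE)
    fix E assume "E \<subseteq> P" "2 \<le> card E"
    moreover obtain a b where "a \<in> E" "b \<in> E" "a \<noteq> b" by (rule two_elements[OF calculation(2)])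
    ultimately show "\<exists>a\<in>E. \<exists>b\<in>E. a \<noteq> b \<and> leaf E a \<and> leaf E b"
      using \<open>\<And>e E. E \<subseteq> P \<Longrightarrow> e \<in> E \<Longrightarrow> leaf E e\<close> by metis
  qed
  have "partial_mono 0 part P"
    unfolding partial_mono_def
  proof (intro allI impI)
    fix c :: "nat \<Rightarrow> bool"
    assume c: "\<forall>u\<in>\<Union>P. \<forall>v\<in>\<Union>P. part u = part v \<and> 0 \<le> part u \<longrightarrow> c u = c v"
    \<comment> \<open>A part without vertices gets the colour \<open>False\<close>.\<close>
    define col where "col i \<longleftrightarrow> (\<exists>v\<in>\<Union>P. part v = i \<and> c v)" for i
    have col: "c v = col (part v)" if "v \<in> \<Union>P" for v
      using c that unfolding col_def by blast
    obtain S b where "S \<subseteq> {..<2 * k}" "card S = k" "\<forall>i\<in>S. col i = b"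
      by (rule two_colour_pigeonhole)
    then have S: "S \<in> ?S" "\<exists>b. \<forall>i\<in>S. col i = b" by auto
    then have e: "f S ` S \<in> P" by (auto simp: P_def)
    have "c (f S i) = col i" if "i \<in> S" for i
    proof -
      have "f S i \<in> \<Union>P" by (rule UnionI[OF e imageI[OF that]])
      then show ?thesis by (simp add: col part)
    qed
    then have "monochromatic c (f S ` S)" using S(2) by (auto simp: monochromatic_def)
    then show "\<exists>e\<in>P. monochromatic c e" using e by blast
  qed
  moreover have "uniform k P"
    using f_inj by (auto simp: uniform_def P_def card_inj_image finite_subset)
  moreover have "\<forall>e\<in>P. inj_on part e \<and> part ` e \<subseteq> {..<2 * k}"
    by (auto simp: P_def inj_on_def part)
  ultimately show ?thesis using that forest by blast
qed

text \<open>Let \<open>C\<close> be the set of copies met by a family of at most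
  \<open>Suc g\<close> edges. With one copy, the property of \<open>P\<close> applies. With at most
  \<open>g\<close> copies, two of them are leaves of \<open>C\<close>, and each contributes a leaf
  of the family. With more than \<open>g\<close> copies, each has a single edge of the family, which
  is a leaf because it contains at most one vertex of \<open>L\<close>. This last case is where the
  bound grows by one.\<close>

lemma locally_forest_amalgam:
  assumes k: "2 \<le> k" and P: "uniform k P" "locally_forest (Suc g) P"
    and L: "\<And>e u v. e \<in> P \<Longrightarrow> u \<in> e \<inter> L \<Longrightarrow> v \<in> e \<inter> L \<Longrightarrow> u = v"
    and H: "finite H" "locally_forest g H"
    and \<epsilon>: "inj \<epsilon>" and \<phi>: "\<And>h. h \<in> H \<Longrightarrow> inj (\<phi> h)" "\<And>h. h \<in> H \<Longrightarrow> \<phi> h ` L = \<epsilon> ` h"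
    and disj: "\<And>h h' v v'. h \<in> H \<Longrightarrow> h' \<in> H \<Longrightarrow> h \<noteq> h' \<Longrightarrow> \<phi> h v = \<phi> h' v' \<Longrightarrow> v \<in> L \<and> v' \<in> L"
  shows "locally_forest (Suc g) (\<Union>h\<in>H. (`) (\<phi> h) ` P)"
  unfolding locally_forest_def
proof (intro allI impI, elim conjE)
  fix E assume E: "E \<subseteq> (\<Union>h\<in>H. (`) (\<phi> h) ` P)" and cE: "2 \<le> card E" "card E \<le> Suc g"
  have finE: "finite E" using cE by (metis card.infinite not_numeral_le_zero)
  define Q where "Q h = {e \<in> P. \<phi> h ` e \<in> E}" for h
  define C where "C = {h \<in> H. Q h \<noteq> {}}"
  have finC: "finite C" "C \<subseteq> H" using H by (auto simp: C_def)
  have finQ: "finite (Q h)" for h using P by (auto simp: Q_def uniform_def)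
  have imQ: "(`) (\<phi> h) ` Q h \<subseteq> E" for h by (auto simp: Q_def)
  have injQ: "inj_on ((`) (\<phi> h)) (Q h)" if "h \<in> C" for h
    using \<phi>(1)[of h] finC that by (auto simp: inj_on_def inj_image_eq_iff)
  have E_eq: "E = (\<Union>h\<in>C. (`) (\<phi> h) ` Q h)"
    using E by (fastforce simp: C_def Q_def)
  \<comment> \<open>As \<open>2 \<le> k\<close>, each edge has a vertex outside \<open>L\<close>.
    That vertex is private to its copy, so edges of different copies are different.\<close>
  have off_L: "\<exists>v\<in>e. v \<notin> L" if "e \<in> P" for e
  proof (rule ccontr)
    assume "\<not> ?thesis"
    then have "\<forall>u\<in>e. \<forall>v\<in>e. u = v" using L[OF that] by auto
    then have "card e \<le> 1" by (metis card_le_Suc0_iff_eq One_nat_def card.infinite le0)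
    then show False using P that k by (auto simp: uniform_def)
  qed
  have distinct: "\<phi> h ` e \<noteq> \<phi> h' ` e'" if "h \<in> C" "h' \<in> C" "h \<noteq> h'" and e: "e \<in> P" for h h' e e'
  proof
    assume "\<phi> h ` e = \<phi> h' ` e'"
    moreover obtain v where "v \<in> e" "v \<notin> L" using off_L[OF e] by blast
    ultimately obtain v' where "\<phi> h v = \<phi> h' v'" by blast
    then show False using disj[of h h' v v'] that finC \<open>v \<notin> L\<close> by blast
  qed
  have "card E = (\<Sum>h\<in>C. card ((`) (\<phi> h) ` Q h))"
  proof -
    have "(`) (\<phi> h) ` Q h \<inter> (`) (\<phi> h') ` Q h' = {}" if "h \<in> C" "h' \<in> C" "h \<noteq> h'" for h h'
      using distinct[OF that] by (auto simp: Q_def)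
    then show ?thesis
      unfolding E_eq using finC finQ by (intro card_UN_disjoint) auto
  qed
  also have "\<dots> = (\<Sum>h\<in>C. card (Q h))"
    using injQ by (intro sum.cong) (auto simp: card_image)
  finally have card_E: "card E = (\<Sum>h\<in>C. card (Q h))" .
  have Q1: "1 \<le> card (Q h)" if "h \<in> C" for h
    using that finQ[of h] by (simp add: C_def Suc_le_eq card_gt_0_iff)
  \<comment> \<open>An edge meets the rest of \<open>E\<close> inside its own copy or at a vertex of
    \<open>L\<close> shared with another copy in \<open>C\<close>.\<close>
  have other: "\<exists>u\<in>e. w = \<phi> h u \<and> (u \<in> \<Union>(Q h - {e}) \<or>
      (u \<in> L \<and> (\<exists>h'\<in>C - {h}. w \<in> \<epsilon> ` h \<inter> \<epsilon> ` h')))"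
    if h: "h \<in> C" "e \<in> Q h" and w: "w \<in> \<phi> h ` e \<inter> \<Union>(E - {\<phi> h ` e})" for h e w
  proof -
    obtain u where u: "u \<in> e" "w = \<phi> h u" using w by blast
    obtain h' e' where e': "h' \<in> C" "e' \<in> Q h'" "w \<in> \<phi> h' ` e'" "\<phi> h' ` e' \<noteq> \<phi> h ` e"
      using w E_eq by blast
    then obtain u' where u': "u' \<in> e'" "w = \<phi> h' u'" by blast
    show ?thesis
    proof (cases "h' = h")
      case True
      then have "u' = u" using u u' \<phi>(1)[of h] h finC by (metis injD subsetD)
      then show ?thesis using True u u' e' by blast
    next
      case False
      then have "u \<in> L \<and> u' \<in> L" using disj[of h h' u u'] h e' u u' finC by auto
      then have "w \<in> \<epsilon> ` h \<inter> \<epsilon> ` h'"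
        using \<phi>(2)[of h] \<phi>(2)[of h'] u u' h e' finC by blast
      then show ?thesis using False u e' \<open>u \<in> L \<and> u' \<in> L\<close> by blast
    qed
  qed
  have single: "\<exists>e\<in>Q h. leaf E (\<phi> h ` e)" if h: "h \<in> C" and one: "card (Q h) = 1" for h
  proof -
    obtain e where e: "Q h = {e}" using one by (metis card_1_singletonE)
    then have eP: "e \<in> P" by (auto simp: Q_def)
    obtain z where z: "e \<inter> L \<subseteq> {z}" using L[OF eP] by blast
    have "\<phi> h ` e \<inter> \<Union>(E - {\<phi> h ` e}) \<subseteq> {\<phi> h z}"
      using other[OF h, of e] e z by blast
    then show ?thesis using e by (auto simp: leaf_def)
  qed
  have leaf_copy: "\<exists>e\<in>Q h. leaf E (\<phi> h ` e)" if h: "h \<in> C" and lf: "leaf C h" for h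
  proof (cases "card (Q h) = 1")
    case True
    then show ?thesis using single h by blast
  next
    case False
    have "Q h \<subseteq> P" by (auto simp: Q_def)
    moreover have "card (Q h) \<le> card E"
      using card_mono[OF finE imQ[of h]] injQ[OF h] by (simp add: card_image)
    moreover have "2 \<le> card (Q h)" using False Q1[OF h] by linarith
    moreover have "card (Q h) \<le> Suc g" using calculation(2) cE(2) by linarith
    ultimately obtain e1 e2 where e12: "e1 \<in> Q h" "e2 \<in> Q h" "e1 \<noteq> e2" "leaf (Q h) e1" "leaf (Q h) e2"
      using locally_forestD[OF P(2)] by metis
    obtain z where z: "h \<inter> \<Union>(C - {h}) \<subseteq> {z}" using lf by (auto simp: leaf_def)
    \<comment> \<open>The preimage of \<open>\<epsilon> z\<close>, if there is one, is the only
      vertex at which copy \<open>h\<close> can meet the other copies in \<open>C\<close>.\<close>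
    obtain v0 where v0: "\<And>v. \<phi> h v = \<epsilon> z \<Longrightarrow> v = v0"
      using \<phi>(1)[of h] h finC by (metis injD subsetD)
    have sub: "\<phi> h ` e \<inter> \<Union>(E - {\<phi> h ` e}) \<subseteq> \<phi> h ` (e \<inter> (\<Union>(Q h - {e}) \<union> {v0}))"
      if e: "e \<in> Q h" for e
    proof
      fix w assume w: "w \<in> \<phi> h ` e \<inter> \<Union>(E - {\<phi> h ` e})"
      obtain u where u: "u \<in> e" "w = \<phi> h u" "u \<in> \<Union>(Q h - {e}) \<or>
          (\<exists>h'\<in>C - {h}. w \<in> \<epsilon> ` h \<inter> \<epsilon> ` h')"
        using other[OF h e w] by (elim bexE conjE) metis
      have "u = v0" if ex: "\<exists>h'\<in>C - {h}. w \<in> \<epsilon> ` h \<inter> \<epsilon> ` h'"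
      proof -
        obtain h' where h': "h' \<in> C - {h}" "w \<in> \<epsilon> ` h \<inter> \<epsilon> ` h'"
          using ex by (elim bexE)
        then have "w \<in> \<epsilon> ` (h \<inter> h')" by (simp add: image_Int[OF \<epsilon>])
        then have "w = \<epsilon> z" using z h'(1) by blast
        then show ?thesis using v0 u by simp
      qed
      then show "w \<in> \<phi> h ` (e \<inter> (\<Union>(Q h - {e}) \<union> {v0}))" using u by blast
    qed
    have "\<exists>e\<in>Q h. \<exists>y. e \<inter> (\<Union>(Q h - {e}) \<union> {v0}) \<subseteq> {y}"
    proof -
      obtain y1 y2 where y: "e1 \<inter> \<Union>(Q h - {e1}) \<subseteq> {y1}" "e2 \<inter> \<Union>(Q h - {e2}) \<subseteq> {y2}"
        using e12 by (auto simp: leaf_def)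
      \<comment> \<open>One of the two leaves of \<open>Q h\<close> survives: a leaf that misses
        \<open>v0\<close> gains no contact, and if both contain \<open>v0\<close>, then
        \<open>v0\<close> is already the contact vertex of \<open>e1\<close>.\<close>
      consider "v0 \<notin> e1" | "v0 \<notin> e2" | "v0 \<in> e1" "v0 \<in> e2" by blast
      then show ?thesis
      proof cases
        case 1
        then have "e1 \<inter> (\<Union>(Q h - {e1}) \<union> {v0}) \<subseteq> {y1}" using y by blast
        then show ?thesis using e12 by blast
      next
        case 2
        then have "e2 \<inter> (\<Union>(Q h - {e2}) \<union> {v0}) \<subseteq> {y2}" using y by blast
        then show ?thesis using e12 by blast
      next
        case 3
        then have "v0 \<in> e1 \<inter> \<Union>(Q h - {e1})" using e12 by blast
        then have "e1 \<inter> (\<Union>(Q h - {e1}) \<union> {v0}) \<subseteq> {y1}" using y by blast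
        then show ?thesis using e12 by blast
      qed
    qed
    then obtain e y where "e \<in> Q h" "e \<inter> (\<Union>(Q h - {e}) \<union> {v0}) \<subseteq> {y}" by blast
    then have "e \<in> Q h" "\<phi> h ` e \<inter> \<Union>(E - {\<phi> h ` e}) \<subseteq> {\<phi> h y}" using sub by blast+
    then show ?thesis unfolding leaf_def by blast
  qed
  have two: "\<exists>e1\<in>E. \<exists>e2\<in>E. e1 \<noteq> e2 \<and> leaf E e1 \<and> leaf E e2"
    if "h1 \<in> C" "h2 \<in> C" "h1 \<noteq> h2"
      and h12: "\<exists>e\<in>Q h1. leaf E (\<phi> h1 ` e)" "\<exists>e\<in>Q h2. leaf E (\<phi> h2 ` e)" for h1 h2
  proof -
    obtain e1 e2 where "e1 \<in> Q h1" "leaf E (\<phi> h1 ` e1)" "e2 \<in> Q h2" "leaf E (\<phi> h2 ` e2)"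
      using h12 by blast
    moreover have "\<phi> h1 ` e1 \<noteq> \<phi> h2 ` e2"
      using distinct[of h1 h2 e1 e2] that calculation by (auto simp: Q_def)
    ultimately show ?thesis by (metis (mono_tags, lifting) Q_def mem_Collect_eq)
  qed
  have "C \<noteq> {}" using E_eq cE by auto
  show "\<exists>e1\<in>E. \<exists>e2\<in>E. e1 \<noteq> e2 \<and> leaf E e1 \<and> leaf E e2"
  proof (cases "card C = 1")
    case True
    then obtain h where h: "C = {h}" by (metis card_1_singletonE)
    then have Eh: "E = (`) (\<phi> h) ` Q h" and ih: "inj (\<phi> h)" using E_eq finC \<phi>(1) by auto
    have "card (Q h) = card E" using card_E h by simp
    moreover have "Q h \<subseteq> P" by (auto simp: Q_def)
    ultimately obtain e1 e2 where e12: "e1 \<in> Q h" "e2 \<in> Q h" "e1 \<noteq> e2" "leaf (Q h) e1" "leaf (Q h) e2"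
      using locally_forestD[OF P(2), of "Q h"] cE by metis
    have tr: "leaf E (\<phi> h ` e)" if e: "e \<in> Q h" "leaf (Q h) e" for e
    proof -
      obtain z where z: "e \<inter> \<Union>(Q h - {e}) \<subseteq> {z}" using e by (auto simp: leaf_def)
      have "w = \<phi> h z" if w: "w \<in> \<phi> h ` e \<inter> \<Union>(E - {\<phi> h ` e})" for w
      proof -
        have hC: "h \<in> C" using h by simp
        from other[OF hC e(1) w] h obtain u where "u \<in> e" "w = \<phi> h u" "u \<in> \<Union>(Q h - {e})"
          by (elim bexE conjE) auto
        then show ?thesis using z by blast
      qed
      then show ?thesis unfolding leaf_def by blast
    qed
    have "\<phi> h ` e1 \<noteq> \<phi> h ` e2" using e12 ih by (simp add: inj_image_eq_iff)
    then show ?thesis using e12 tr Eh by blast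
  next
    case False
    then have C2: "2 \<le> card C" using \<open>C \<noteq> {}\<close> finC
      by (metis One_nat_def Suc_1 Suc_leI card_gt_0_iff le_neq_implies_less)
    show ?thesis
    proof (cases "card C \<le> g")
      case True
      then obtain h1 h2 where "h1 \<in> C" "h2 \<in> C" "h1 \<noteq> h2" "leaf C h1" "leaf C h2"
        by (rule locally_forestD[OF H(2) finC(2) C2])
      then show ?thesis by (intro two[of h1 h2] leaf_copy)
    next
      case False
      \<comment> \<open>More than \<open>g\<close> copies share at most \<open>Suc g\<close> edges,
        and at least two edges in one copy would exceed this.\<close>
      have all1: "card (Q h) = 1" if h: "h \<in> C" for h
      proof (rule ccontr)
        assume "card (Q h) \<noteq> 1"
        then have "2 \<le> card (Q h)" using Q1[OF h] by simp
        moreover have "(\<Sum>h\<in>C - {h}. 1) \<le> (\<Sum>h\<in>C - {h}. card (Q h))"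
          using Q1 by (intro sum_mono) auto
        ultimately have "2 + (card C - 1) \<le> card E"
          using card_E finC h by (simp add: sum.remove)
        then show False using False cE C2 by linarith
      qed
      obtain h1 h2 where "h1 \<in> C" "h2 \<in> C" "h1 \<noteq> h2"
        by (rule two_elements[OF C2])
      then show ?thesis by (intro two[of h1 h2] single all1)
    qed
  qed
qed

text \<open>If each hypergraph vertex \<open>z\<close> is coloured like \<open>\<epsilon> z\<close>,
  some hyperedge \<open>h\<close> is monochromatic; so in copy \<open>h\<close> part
  \<open>j\<close> is monochromatic without being assumed to be, and the assumption on later parts
  is inherited. The size of part \<open>j\<close> is not under control, which is why
  \<open>IH\<close> covers every uniformity \<open>r\<close>.\<close>

lemma partite_step:
  assumes IH: "\<And>r. \<exists>H :: nat set set. uniform r H \<and> locally_forest g H \<and> (\<forall>c. \<exists>h\<in>H. monochromatic c h)"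
    and k: "2 \<le> k" and P: "uniform k P" "locally_forest (Suc g) P"
    and part: "\<forall>e\<in>P. inj_on part e \<and> part ` e \<subseteq> {..<n}" and mono: "partial_mono j part P"
  obtains P' part' where "uniform k P'" "\<forall>e\<in>P'. inj_on part' e \<and> part' ` e \<subseteq> {..<n}"
    "locally_forest (Suc g) P'" "partial_mono (Suc j) part' P'"
proof -
  define L where "L = {v \<in> \<Union>P. part v = j}"
  have finL: "finite L" using P by (auto simp: L_def uniform_def)
  obtain H :: "nat set set" where H: "uniform (card L) H" "locally_forest g H" "\<forall>c. \<exists>h\<in>H. monochromatic c h"
    using IH by blast
  obtain \<epsilon> :: "nat \<Rightarrow> nat" and \<phi> :: "nat set \<Rightarrow> nat \<Rightarrow> nat" where \<epsilon>: "inj \<epsilon>"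
    and \<phi>: "\<And>h. h \<in> H \<Longrightarrow> inj (\<phi> h)" "\<And>h. h \<in> H \<Longrightarrow> \<phi> h ` L = \<epsilon> ` h"
    and disj: "\<And>h h' v v'. h \<in> H \<Longrightarrow> h' \<in> H \<Longrightarrow> h \<noteq> h' \<Longrightarrow> \<phi> h v = \<phi> h' v' \<Longrightarrow> v \<in> L \<and> v' \<in> L"
    by (rule gluing_maps[OF H(1) finL]) blast
  define P' where "P' = (\<Union>h\<in>H. (`) (\<phi> h) ` P)"
  \<comment> \<open>This is well defined: vertices shared by copies come from \<open>L\<close>, and
    all of \<open>L\<close> is in part \<open>j\<close>.\<close>
  define part' where "part' w = part (SOME v. \<exists>h\<in>H. w = \<phi> h v)" for w
  have part': "part' (\<phi> h v) = part v" if h: "h \<in> H" for h v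
  proof -
    define u where "u = (SOME u. \<exists>h'\<in>H. \<phi> h v = \<phi> h' u)"
    have "\<exists>h'\<in>H. \<phi> h v = \<phi> h' u"
      unfolding u_def by (rule someI[of _ v]) (use h in blast)
    then obtain h' where h': "h' \<in> H" "\<phi> h v = \<phi> h' u" by blast
    have "part u = part v"
    proof (cases "h' = h")
      case True
      then have "v = u" using h' by (auto intro!: injD[OF \<phi>(1)[OF h], of v u])
      then show ?thesis by simp
    next
      case False
      then show ?thesis using disj[OF h h'(1) _ h'(2)] by (auto simp: L_def)
    qed
    then show ?thesis by (simp add: part'_def u_def)
  qed
  have inter: "u = v" if "e \<in> P" "u \<in> e \<inter> L" "v \<in> e \<inter> L" for e u v
    using that part by (auto simp: L_def dest: inj_onD)
  have "locally_forest (Suc g) P'"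
    unfolding P'_def
    by (rule locally_forest_amalgam[OF k P inter _ H(2) \<epsilon> \<phi> disj]) (use H in \<open>auto simp: uniform_def\<close>)
  moreover have "uniform k P'"
    using P H(1) \<phi>(1) by (auto simp: uniform_def P'_def card_inj_image)
  moreover have "\<forall>e\<in>P'. inj_on part' e \<and> part' ` e \<subseteq> {..<n}"
  proof
    fix e' assume "e' \<in> P'"
    then obtain h e where e: "h \<in> H" "e \<in> P" "e' = \<phi> h ` e" by (auto simp: P'_def)
    then have "part' ` e' = part ` e" by (auto simp: part' image_image)
    moreover have "inj_on part' e'"
      using e part by (auto simp: inj_on_def part')
    ultimately show "inj_on part' e' \<and> part' ` e' \<subseteq> {..<n}" using part e by auto
  qed
  moreover have "partial_mono (Suc j) part' P'"
    unfolding partial_mono_def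
  proof (intro allI impI)
    fix c :: "nat \<Rightarrow> bool"
    assume c: "\<forall>u\<in>\<Union>P'. \<forall>v\<in>\<Union>P'. part' u = part' v \<and> Suc j \<le> part' u \<longrightarrow> c u = c v"
    obtain h where h: "h \<in> H" "monochromatic (c \<circ> \<epsilon>) h" using H(3) by blast
    then obtain b where b: "\<forall>z\<in>h. c (\<epsilon> z) = b" by (auto simp: monochromatic_def)
    have cL: "c (\<phi> h v) = b" if "v \<in> L" for v
    proof -
      have "\<phi> h v \<in> \<epsilon> ` h" using \<phi>(2)[OF h(1)] that by blast
      then show ?thesis using b by auto
    qed
    have "c (\<phi> h u) = c (\<phi> h v)"
      if uv: "u \<in> \<Union>P" "v \<in> \<Union>P" "part u = part v" "j \<le> part u" for u v
    proof (cases "part u = j")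
      case True
      then show ?thesis using cL uv by (simp add: L_def)
    next
      case False
      have "\<phi> h u \<in> \<Union>P'" "\<phi> h v \<in> \<Union>P'" using uv h by (auto simp: P'_def)
      then show ?thesis using c[rule_format, of "\<phi> h u" "\<phi> h v"] False uv h by (simp add: part')
    qed
    then obtain e where "e \<in> P" "monochromatic (\<lambda>v. c (\<phi> h v)) e"
      using mono unfolding partial_mono_def by (metis (no_types, lifting))
    then show "\<exists>e\<in>P'. monochromatic c e"
      using h by (auto simp: P'_def monochromatic_def)
  qed
  ultimately show ?thesis using that by blast
qed

theorem sparse_chromatic_hypergraph:
  "\<exists>E :: nat set set. uniform k E \<and> locally_forest g E \<and> (\<forall>c. \<exists>e\<in>E. monochromatic c e)"
proof (induction g arbitrary: k)
  case 0
  \<comment> \<open>For \<open>g = 0\<close> the forest condition is empty, and all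
    \<open>k\<close>-subsets of \<open>2 * k\<close> points will do.\<close>
  let ?E = "{S :: nat set. S \<subseteq> {..<2 * k} \<and> card S = k}"
  have "\<exists>e\<in>?E. monochromatic c e" for c
  proof -
    obtain S b where "S \<subseteq> {..<2 * k}" "card S = k" "\<forall>i\<in>S. c i = b"
      by (rule two_colour_pigeonhole)
    then have "S \<in> ?E" "monochromatic c S" by (auto simp: monochromatic_def)
    then show ?thesis by blast
  qed
  moreover have "uniform k ?E" by (auto simp: uniform_def intro: finite_subset)
  ultimately show ?case by (intro exI[of _ ?E]) (auto simp: locally_forest_def)
next
  case (Suc g)
  note IHg = Suc.IH
  show ?case
  proof (cases "2 \<le> k")
    case False
    \<comment> \<open>An edge with at most one vertex is monochromatic under every colouring. This
      case is split off because \<open>partite_step\<close> relies on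
      \<open>2 \<le> k\<close>.\<close>
    then have "\<exists>b. \<forall>v\<in>{..<k}. c v = b" for c :: "nat \<Rightarrow> bool"
      by (intro exI[of _ "c 0"]) (auto simp: not_le less_Suc_eq numeral_2_eq_2)
    then show ?thesis
      by (intro exI[of _ "{{..<k}}"])
        (auto simp: uniform_def locally_forest_def monochromatic_def dest!: subset_singletonD)
  next
    case True
    have "\<exists>P part. uniform k P \<and> (\<forall>e\<in>P. inj_on part e \<and> part ` e \<subseteq> {..<2 * k}) \<and>
        locally_forest (Suc g) P \<and> partial_mono j part P" for j
    proof (induction j)
      case 0
      show ?case using partite_start[of k "Suc g"] True by (metis One_nat_def Suc_1 Suc_leD)
    next
      case (Suc j)
      then obtain P part where "uniform k P" "locally_forest (Suc g) P"
        "\<forall>e\<in>P. inj_on part e \<and> part ` e \<subseteq> {..<2 * k}" "partial_mono j part P"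
        by blast
      from partite_step[OF IHg True this] show ?case by metis
    qed
    \<comment> \<open>After \<open>2 * k\<close> steps no part is left on which anything is
      assumed.\<close>
    then obtain P part where P: "uniform k P" "\<forall>e\<in>P. inj_on part e \<and> part ` e \<subseteq> {..<2 * k}"
      "locally_forest (Suc g) P" "partial_mono (2 * k) part P"
      by blast
    have "\<exists>e\<in>P. monochromatic c e" for c
    proof -
      have "part u < 2 * k" if "u \<in> \<Union>P" for u using P(2) that by blast
      then show ?thesis using partial_monoD[OF P(4), of c] by (meson not_le)
    qed
    then show ?thesis using P by blast
  qed
qed

section \<open>Star gadgets\<close>

lemma emb_complete:
  assumes G: "conn3 G" and K: "card K = card (verts G)" "clique K R"
  shows "emb G R"
proof -
  have "3 \<le> card (verts G)" "finite (verts G)" using G by (auto simp: conn3_def sgraph_def)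
  then have "finite K" using K by (metis card.infinite not_numeral_le_zero)
  then obtain f where f: "bij_betw f (verts G) K"
    using finite_same_card_bij[OF \<open>finite (verts G)\<close>] K by metis
  have "f ` e \<in> R" if eG: "e \<in> edges G" for e
  proof -
    obtain p q where e: "e = {p, q}" "p \<noteq> q" "p \<in> verts G" "q \<in> verts G"
      using conn3_edge[OF G eG] by (auto simp: card_2_iff)
    then have "f p \<in> K" "f q \<in> K" "f p \<noteq> f q" using f by (auto simp: bij_betw_def inj_on_eq_iff)
    then show ?thesis using K(2) e(1) by (simp add: clique_def)
  qed
  then show ?thesis using f by (auto simp: emb_def bij_betw_def)
qed

lemma arrowing_exists:
  assumes G: "conn3 G" and H: "conn3 H"
  obtains E :: "nat set set" where "simple_edges E" "\<not> (\<exists>R. good G H E R)"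
proof -
  obtain r where r: "\<forall>V (R :: nat set set). finite V \<and> card V \<ge> r \<longrightarrow>
      (\<exists>K\<subseteq>V. card K = card (verts G) \<and> clique K R \<or> card K = card (verts H) \<and> indep K R)"
    using ramsey2[of "card (verts G)" "card (verts H)"] by blast
  let ?E = "nsets {..<r} 2"
  have "\<not> good G H ?E R" for R
  proof
    assume R: "good G H ?E R"
    obtain K where K: "K \<subseteq> {..<r}" "card K = card (verts G) \<and> clique K R \<or> card K = card (verts H) \<and> indep K R"
      using r[rule_format, of "{..<r}" R] by auto
    from K(2) show False
    proof
      assume "card K = card (verts G) \<and> clique K R"
      then show False using emb_complete[OF G] R by (auto simp: good_def)
    next
      assume a: "card K = card (verts H) \<and> indep K R"
      then have "clique K (?E - R)" using K(1) by (auto simp: clique_def indep_def)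
      then show False using emb_complete[OF H] R a by (auto simp: good_def)
    qed
  qed
  moreover have "simple_edges ?E"
    by (auto simp: simple_edges_def finite_imp_finite_nsets nsets_def)
  ultimately show ?thesis using that by blast
qed

lemma minimal_arrowing:
  assumes "finite E" "\<not> (\<exists>R. good G H E R)"
  obtains M where "M \<subseteq> E" "\<not> (\<exists>R. good G H M R)" "\<And>D. D \<subset> M \<Longrightarrow> \<exists>R. good G H D R"
proof -
  have "\<exists>M\<subseteq>E. \<not> (\<exists>R. good G H M R) \<and> (\<forall>D. D \<subset> M \<longrightarrow> (\<exists>R. good G H D R))"
    using assms
  proof (induction E rule: finite_psubset_induct)
    case (psubset E)
    show ?case
    proof (cases "\<forall>D. D \<subset> E \<longrightarrow> (\<exists>R. good G H D R)")
      case True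
      then show ?thesis using psubset.prems by auto
    next
      case False
      then obtain D where D: "D \<subset> E" "\<not> (\<exists>R. good G H D R)" by auto
      obtain M where "M \<subseteq> D" "\<not> (\<exists>R. good G H M R) \<and> (\<forall>D. D \<subset> M \<longrightarrow> (\<exists>R. good G H D R))"
        using psubset.IH[OF D] by auto
      then show ?thesis using D(1) by (intro exI[of _ M]) auto
    qed
  qed
  then show ?thesis using that by blast
qed

text \<open>A vertex of a copy placed on \<open>x\<close> would need two edges there, but
  \<open>{v, x}\<close> is the only edge available; so no copy uses it.\<close>

lemma emb_pendant:
  assumes G: "conn3 G" and em: "emb G (insert {v, x} R)" and x: "\<forall>r\<in>R. x \<notin> r"
  shows "emb G R"
proof -
  obtain f where f: "inj_on f (verts G)" "\<forall>e\<in>edges G. f ` e \<in> insert {v, x} R"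
    using em by (auto simp: emb_def)
  have "f ` e \<noteq> {v, x}" if e: "e \<in> edges G" for e
  proof
    assume "f ` e = {v, x}"
    then obtain p where "p \<in> e" "f p = x" by (metis imageE insertI1 insert_commute)
    moreover then have "p \<in> verts G" using conn3_edge[OF G e] by blast
    then obtain q r where qr: "q \<noteq> r" "{p, q} \<in> edges G" "{p, r} \<in> edges G"
      by (rule conn3_two_neighbours[OF G])
    ultimately have eq: "{x, f q} = {v, x}" "{x, f r} = {v, x}"
      using f(2)[rule_format, OF qr(2)] f(2)[rule_format, OF qr(3)] x by auto
    have V: "q \<in> verts G" "r \<in> verts G" "p \<noteq> q" "p \<noteq> r"
      using qr(2,3) conn3_edge[OF G] by force+
    then have "f q \<noteq> x" "f r \<noteq> x" "f q \<noteq> f r"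
      using f(1) \<open>f p = x\<close> \<open>p \<in> verts G\<close> qr(1) by (metis inj_on_eq_iff)+
    then show False using eq by (auto simp: doubleton_eq_iff)
  qed
  then show ?thesis using f by (auto simp: emb_def)
qed

text \<open>The last clause makes the glued graph arrow. The clause before it says that no spoke is
  forced and is what allows pieces of a subgraph to be coloured compatibly.\<close>

definition star_gadget :: "'a graph \<Rightarrow> 'b graph \<Rightarrow> nat set set \<Rightarrow> nat \<Rightarrow> nat set \<Rightarrow> bool" where
  "star_gadget G H E x L \<longleftrightarrow> simple_edges E \<and> (\<forall>l\<in>L. {x, l} \<in> E) \<and> (\<exists>R. good G H E R) \<and>
     (\<forall>l\<in>L. (\<exists>R. good G H E R \<and> {x, l} \<in> R) \<and> (\<exists>R. good G H E R \<and> {x, l} \<notin> R)) \<and>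
     (\<forall>R. good G H E R \<longrightarrow> (\<exists>l\<in>L. {x, l} \<in> R) \<and> (\<exists>l\<in>L. {x, l} \<notin> R))"

text \<open>The forced colour is red. A forced blue edge is expressed by
  \<open>determined H G\<close>, since exchanging the two graphs exchanges the colours.\<close>

definition determined :: "'a graph \<Rightarrow> 'b graph \<Rightarrow> nat set set \<Rightarrow> nat set \<Rightarrow> bool" where
  "determined G H E e \<longleftrightarrow> simple_edges E \<and> e \<in> E \<and> (\<exists>R. good G H E R) \<and> (\<forall>R. good G H E R \<longrightarrow> e \<in> R)"

lemma star_gadget_if_undetermined:
  assumes G: "conn3 G" and H: "conn3 H"
    and nr: "\<not> (\<exists>E e. determined G H E e)" and nb: "\<not> (\<exists>E e. determined H G E e)"
  shows "\<exists>E x L. star_gadget G H E x L"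
proof -
  obtain E0 :: "nat set set" where E0: "simple_edges E0" "\<not> (\<exists>R. good G H E0 R)"
    using arrowing_exists[OF G H] .
  then have "finite E0" by (simp add: simple_edges_def)
  obtain M where M: "M \<subseteq> E0" "\<not> (\<exists>R. good G H M R)" "\<And>D. D \<subset> M \<Longrightarrow> \<exists>R. good G H D R"
    by (rule minimal_arrowing[OF \<open>finite E0\<close> E0(2)]) blast
  have simple: "simple_edges M" using simple_edges_subset E0 M by blast
  \<comment> \<open>The empty edge set has a good colouring, so \<open>M\<close> has an edge that
    can be removed.\<close>
  have "good G H {} ({} :: nat set set)"
    using conn3_not_emb_small[OF G, of "{}"] conn3_not_emb_small[OF H, of "{}"] by (auto simp: good_def)
  then have "M \<noteq> {}" using M(2) by blast
  then obtain e where "e \<in> M" by blast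
  then obtain v x where vx: "{v, x} \<in> M" "v \<noteq> x"
    using simple by (metis simple_edges_def card_2_iff)
  let ?E = "M - {{v, x}}" and ?L = "{l. {x, l} \<in> M - {{v, x}}}"
  have exR: "\<exists>R. good G H ?E R" using M(3) vx by blast
  have simpleE: "simple_edges ?E" using simple simple_edges_subset by blast
  have at_x: "\<exists>l. e = {x, l}" if "e \<in> M" "x \<in> e" for e
    using simple that by (auto simp: simple_edges_def card_2_iff)
  have "(\<exists>l\<in>?L. {x, l} \<in> R) \<and> (\<exists>l\<in>?L. {x, l} \<notin> R)" if R: "good G H ?E R" for R
  proof
    show "\<exists>l\<in>?L. {x, l} \<in> R"
    proof (rule ccontr)
      assume "\<not> ?thesis"
      then have "\<forall>r\<in>R. x \<notin> r" using R at_x by (fastforce simp: good_def)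
      then have "\<not> emb G (insert {v, x} R)" using emb_pendant[OF G, of v x R] R by (auto simp: good_def)
      moreover have "M - insert {v, x} R = ?E - R" by auto
      ultimately have "good G H M (insert {v, x} R)" using R vx by (auto simp: good_def)
      then show False using M by blast
    qed
    show "\<exists>l\<in>?L. {x, l} \<notin> R"
    proof (rule ccontr)
      assume "\<not> ?thesis"
      then have "\<forall>r\<in>?E - R. x \<notin> r" using R at_x by (fastforce simp: good_def)
      then have "\<not> emb H (insert {v, x} (?E - R))" using emb_pendant[OF H, of v x "?E - R"] R by (auto simp: good_def)
      moreover have "M - R = insert {v, x} (?E - R)" using R vx by (auto simp: good_def)
      ultimately have "good G H M R" using R by (auto simp: good_def)
      then show False using M by blast
    qed
  qed
  moreover have "\<exists>R. good G H ?E R \<and> e \<notin> R" if "e \<in> ?E" for e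
    using nr exR simpleE that by (auto simp: determined_def)
  moreover have "\<exists>R. good G H ?E R \<and> e \<in> R" if e: "e \<in> ?E" for e
  proof -
    have "\<exists>R. good H G ?E R" using exR good_swap by (metis good_def)
    then obtain R where R: "good H G ?E R" "e \<notin> R" using nb simpleE e by (auto simp: determined_def)
    then have "good G H ?E (?E - R)" using good_swap by (metis good_def)
    then show ?thesis using R e by blast
  qed
  ultimately have "star_gadget G H ?E x ?L"
    using exR simpleE unfolding star_gadget_def by blast
  then show ?thesis by blast
qed

section \<open>Forcing edges by attached copies\<close>

lemma fresh_relabelling:
  fixes A D :: "nat set"
  assumes "finite A" "inj_on \<psi> D" "\<psi> ` D \<subseteq> A"
  obtains \<phi> where "inj \<phi>" "\<And>v. v \<in> D \<Longrightarrow> \<phi> v = \<psi> v" "\<And>v. v \<notin> D \<Longrightarrow> \<phi> v \<notin> A"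
proof -
  obtain N where N: "\<forall>a\<in>A. a < N" using assms(1) by (auto simp: finite_nat_set_iff_bounded)
  \<comment> \<open>Points outside \<open>D\<close> are shifted past all of \<open>A\<close>, which
    contains the values of \<open>\<psi>\<close>.\<close>
  let ?\<phi> = "\<lambda>v. if v \<in> D then \<psi> v else v + N"
  have "inj ?\<phi>"
    using assms N by (fastforce simp: inj_def inj_on_def)
  then show ?thesis using that[of ?\<phi>] N by force
qed

text \<open>A copy of \<open>D\<close> is laid on \<open>F\<close> such that \<open>d\<close> falls
  on \<open>f\<close> and all other vertices are new. The overlap is the pair \<open>f\<close>, red
  in every good colouring of the copy, so a good colouring of \<open>F\<close> with red
  \<open>f\<close> can be glued to one of the copy.\<close>

lemma attach_determiner:
  fixes F :: "nat set set"
  assumes G: "conn3 G" and H: "conn3 H" and F: "simple_edges F" "f \<in> F" and det: "determined G H D d"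
  obtains F' where "F \<subseteq> F'" "simple_edges F'" "\<And>R. good G H F' R \<Longrightarrow> f \<in> R"
    "\<And>R. good G H F R \<Longrightarrow> f \<in> R \<Longrightarrow> \<exists>R'. good G H F' R' \<and> R' \<inter> F = R"
proof -
  obtain a b where f: "f = {a, b}" "a \<noteq> b" using F by (auto simp: simple_edges_def card_2_iff)
  have D: "simple_edges D" "d \<in> D" using det by (auto simp: determined_def)
  then obtain p q where d: "d = {p, q}" "p \<noteq> q" by (auto simp: simple_edges_def card_2_iff)
  let ?\<psi> = "\<lambda>v. if v = p then a else b"
  have "inj_on ?\<psi> {p, q}" "?\<psi> ` {p, q} \<subseteq> \<Union>F" using f d F by (auto simp: inj_on_def)
  then obtain \<phi> where \<phi>: "inj \<phi>" "\<And>v. v \<in> {p, q} \<Longrightarrow> \<phi> v = ?\<psi> v" "\<And>v. v \<notin> {p, q} \<Longrightarrow> \<phi> v \<notin> \<Union>F"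
    by (rule fresh_relabelling[OF simple_edges_finite_Union[OF F(1)]]) blast
  let ?D = "(`) \<phi> ` D"
  have \<phi>d: "\<phi> ` d = f" using \<phi>(2) d f by auto
  then have fD: "f \<in> ?D" using D by blast
  have simpleD: "simple_edges ?D" using simple_edges_image D \<phi> by blast
  have red: "f \<in> R" if "good G H ?D R" for R
    using good_pullback[OF G H \<phi>(1) that] det \<phi>d by (auto simp: determined_def)
  obtain RD where RD: "good G H D RD" "d \<in> RD" using det by (auto simp: determined_def)
  then have gD: "good G H ?D ((`) \<phi> ` RD)" using good_inj_image[OF G H \<phi>(1)] by (auto simp: good_def)
  have sep: "\<Union>F \<inter> \<Union>?D \<subseteq> {a, b}"
  proof
    fix w assume w: "w \<in> \<Union>F \<inter> \<Union>?D"
    then obtain v where v: "w = \<phi> v" by blast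
    then have "v \<in> {p, q}" using \<phi>(3) w by blast
    then show "w \<in> {a, b}" using \<phi>(2)[of v] v by auto
  qed
  show ?thesis
  proof (rule that[of "F \<union> ?D"])
    show "simple_edges (F \<union> ?D)" using simple_edges_Un F simpleD by blast
    show "f \<in> R" if "good G H (F \<union> ?D) R" for R
      using red[OF good_restrict[OF that]] by auto
    show "\<exists>R'. good G H (F \<union> ?D) R' \<and> R' \<inter> F = R" if R: "good G H F R" "f \<in> R" for R
    proof -
      have "{a, b} \<in> (`) \<phi> ` RD" using red[OF gD] f by simp
      then have uv: "{a, b} \<in> ?D \<and> ({a, b} \<in> R \<longleftrightarrow> {a, b} \<in> (`) \<phi> ` RD)" "{a, b} \<in> F"
        using R(2) F(2) fD f by simp_all
      note gl = good_glue[OF G H R(1) gD F(1) simpleD sep uv]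
      show ?thesis using gl(1,2) by (intro exI conjI)
    qed
  qed auto
qed

lemma attach_determiners:
  fixes F :: "nat set set"
  assumes G: "conn3 G" and H: "conn3 H" and F: "simple_edges F" "T \<subseteq> F" and det: "determined G H D d"
  obtains F' where "F \<subseteq> F'" "simple_edges F'" "\<And>R. good G H F' R \<Longrightarrow> T \<subseteq> R"
    "\<And>R. good G H F R \<Longrightarrow> T \<subseteq> R \<Longrightarrow> \<exists>R'. good G H F' R' \<and> R' \<inter> F = R"
proof -
  have "finite T" using F by (auto simp: simple_edges_def intro: finite_subset)
  then have "T \<subseteq> F \<longrightarrow> (\<exists>F'. F \<subseteq> F' \<and> simple_edges F' \<and> (\<forall>R. good G H F' R \<longrightarrow> T \<subseteq> R) \<and>
      (\<forall>R. good G H F R \<and> T \<subseteq> R \<longrightarrow> (\<exists>R'. good G H F' R' \<and> R' \<inter> F = R)))"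
  proof (induction T rule: finite_induct)
    case empty
    then show ?case using F(1) by (intro impI exI[of _ F]) (auto simp: good_def)
  next
    case (insert f T)
    show ?case
    proof
      assume sub: "insert f T \<subseteq> F"
      then obtain F1 where F1: "F \<subseteq> F1" "simple_edges F1" "\<forall>R. good G H F1 R \<longrightarrow> T \<subseteq> R"
        "\<forall>R. good G H F R \<and> T \<subseteq> R \<longrightarrow> (\<exists>R'. good G H F1 R' \<and> R' \<inter> F = R)"
        using insert.IH by auto
      have "f \<in> F1" using F1 sub by auto
      from attach_determiner[OF G H F1(2) this det]
      obtain F2 where F2: "F1 \<subseteq> F2" "simple_edges F2" "\<And>R. good G H F2 R \<Longrightarrow> f \<in> R"
        "\<And>R. good G H F1 R \<Longrightarrow> f \<in> R \<Longrightarrow> \<exists>R'. good G H F2 R' \<and> R' \<inter> F1 = R"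
        by metis
      have "insert f T \<subseteq> R" if "good G H F2 R" for R
        using F2(3)[OF that] F1(3) good_restrict[OF that F2(1)] by auto
      moreover have "\<exists>R'. good G H F2 R' \<and> R' \<inter> F = R" if R: "good G H F R" "insert f T \<subseteq> R" for R
      proof -
        obtain R1 where R1: "good G H F1 R1" "R1 \<inter> F = R" using F1(4) R by auto
        moreover have "f \<in> R1" using R1 R by auto
        ultimately obtain R2 where "good G H F2 R2" "R2 \<inter> F1 = R1" using F2(4) by blast
        moreover have "R2 \<inter> F = (R2 \<inter> F1) \<inter> F" using F1 by auto
        ultimately show ?thesis using R1 by auto
      qed
      ultimately show "\<exists>F'. F \<subseteq> F' \<and> simple_edges F' \<and> (\<forall>R. good G H F' R \<longrightarrow> insert f T \<subseteq> R) \<and>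
          (\<forall>R. good G H F R \<and> insert f T \<subseteq> R \<longrightarrow> (\<exists>R'. good G H F' R' \<and> R' \<inter> F = R))"
        using F1(1) F2(1,2) by (intro exI[of _ F2]) auto
    qed
  qed
  then have "\<exists>F'. F \<subseteq> F' \<and> simple_edges F' \<and> (\<forall>R. good G H F' R \<longrightarrow> T \<subseteq> R) \<and>
      (\<forall>R. good G H F R \<and> T \<subseteq> R \<longrightarrow> (\<exists>R'. good G H F' R' \<and> R' \<inter> F = R))"
    using F(2) by (rule mp)
  then obtain F' where "F \<subseteq> F'" "simple_edges F'" "\<forall>R. good G H F' R \<longrightarrow> T \<subseteq> R"
    "\<forall>R. good G H F R \<and> T \<subseteq> R \<longrightarrow> (\<exists>R'. good G H F' R' \<and> R' \<inter> F = R)"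
    by (elim exE conjE)
  then show ?thesis by (intro that[of F']) auto
qed

text \<open>The two edges at \<open>x\<close> are the ones later left unforced: both in the gadget,
  one alone when a forced edge of the opposite colour is produced.\<close>

lemma nat_copy:
  assumes G: "conn3 G"
  obtains E :: "nat set set" and x a b where "simple_edges E" "emb G E" "card E = card (edges G)"
    "{x, a} \<in> E" "{x, b} \<in> E" "a \<noteq> b"
proof -
  obtain g :: "'a \<Rightarrow> nat" where g: "inj_on g (verts G)"
    using conn3_finite[OF G] finite_imp_inj_to_nat_seg by metis
  obtain p where p: "p \<in> verts G" using G by (force simp: conn3_def)
  obtain q r where qr: "q \<noteq> r" "{p, q} \<in> edges G" "{p, r} \<in> edges G"
    using conn3_two_neighbours[OF G p] .
  let ?E = "(`) g ` edges G"
  have V: "q \<in> verts G" "r \<in> verts G" using qr conn3_edge[OF G] by blast+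
  have "card (g ` e) = 2" if "e \<in> edges G" for e
    using conn3_edge[OF G that] g by (metis card_image inj_on_subset)
  then have "simple_edges ?E" using conn3_finite[OF G] by (auto simp: simple_edges_def)
  moreover have "emb G ?E" using g by (auto simp: emb_def)
  moreover have "inj_on ((`) g) (edges G)"
    using inj_on_image_eq_iff[OF g] conn3_edge[OF G] by (intro inj_onI) auto
  then have "card ?E = card (edges G)" by (rule card_image)
  moreover have "{g p, g q} \<in> ?E" "{g p, g r} \<in> ?E"
    using imageI[OF qr(2), of "(`) g"] imageI[OF qr(3), of "(`) g"] by simp_all
  moreover have "g q \<noteq> g r" using g V qr(1) by (simp add: inj_on_eq_iff)
  ultimately show ?thesis using that by blast
qed

text \<open>Red has fewer edges than \<open>G\<close>, and blue has at most two edges, fewer than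
  \<open>H\<close>.\<close>

lemma good_proper_subcopy:
  assumes G: "conn3 G" and H: "conn3 H" and E: "simple_edges E" "card E = card (edges G)"
    and R: "R \<subset> E" "card (E - R) < 3"
  shows "good G H E R"
proof -
  have "finite E" using E by (simp add: simple_edges_def)
  then have "card R < card E" "finite R" using R by (auto simp: psubset_card_mono finite_subset psubset_imp_subset)
  then have "\<not> emb G R" using emb_card_le[OF G] E(2) by force
  moreover have "\<not> emb H (E - R)" using conn3_not_emb_small[OF H _ R(2)] \<open>finite E\<close> by blast
  ultimately show ?thesis using R by (auto simp: good_def)
qed

lemma determined_swap:
  assumes G: "conn3 G" and H: "conn3 H" and det: "determined G H D d"
  shows "\<exists>E e. determined H G E e"
proof -
  obtain E :: "nat set set" and x a b where E: "simple_edges E" "emb G E" "card E = card (edges G)"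
    and xa: "{x, a} \<in> E" by (metis nat_copy[OF G])
  let ?f = "{x, a}" and ?T = "E - {{x, a}}"
  obtain F where F: "E \<subseteq> F" "simple_edges F" "\<And>R. good G H F R \<Longrightarrow> ?T \<subseteq> R"
    "\<And>R. good G H E R \<Longrightarrow> ?T \<subseteq> R \<Longrightarrow> \<exists>R'. good G H F R' \<and> R' \<inter> E = R"
    using attach_determiners[OF G H E(1) _ det, of ?T] by blast
  have "E - ?T = {?f}" using xa by auto
  then have "good G H E ?T" using xa by (intro good_proper_subcopy[OF G H E(1,3)]) auto
  then obtain R0 where "good G H F R0" using F(4) by blast
  then have "\<exists>R. good H G F R" using good_swap by (metis good_def)
  moreover have "?f \<in> R" if R: "good H G F R" for R
  proof (rule ccontr)
    assume "?f \<notin> R"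
    have "good G H F (F - R)" using R good_swap by (metis good_def)
    moreover then have "E \<subseteq> F - R" using F(1,3) \<open>?f \<notin> R\<close> xa by blast
    ultimately show False using emb_mono[OF E(2)] by (auto simp: good_def)
  qed
  ultimately show ?thesis using F xa unfolding determined_def by blast
qed

text \<open>With both edges red, \<open>E\<close> would be a red copy of \<open>G\<close>. With
  exactly one of them blue, the colouring of \<open>E\<close> is good and extends to the attached
  copies.\<close>

lemma two_edge_gadget:
  assumes G: "conn3 G" and H: "conn3 H" and det: "determined G H D d"
  obtains E :: "nat set set" and x a b where "simple_edges E" "{x, a} \<in> E" "{x, b} \<in> E"
    "\<forall>R. good G H E R \<longrightarrow> {x, a} \<notin> R \<or> {x, b} \<notin> R"
    "\<exists>R. good G H E R \<and> {x, a} \<in> R \<and> {x, b} \<notin> R"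
    "\<exists>R. good G H E R \<and> {x, a} \<notin> R \<and> {x, b} \<in> R"
proof -
  obtain E :: "nat set set" and x a b where E: "simple_edges E" "emb G E" "card E = card (edges G)"
    and xab: "{x, a} \<in> E" "{x, b} \<in> E" "a \<noteq> b" by (metis nat_copy[OF G])
  let ?T = "E - {{x, a}, {x, b}}"
  have neq: "{x, a} \<noteq> {x, b}" using xab(3) by (auto simp: doubleton_eq_iff)
  obtain F where F: "E \<subseteq> F" "simple_edges F" "\<And>R. good G H F R \<Longrightarrow> ?T \<subseteq> R"
    "\<And>R. good G H E R \<Longrightarrow> ?T \<subseteq> R \<Longrightarrow> \<exists>R'. good G H F R' \<and> R' \<inter> E = R"
    using attach_determiners[OF G H E(1) _ det, of ?T] by blast
  have ext: "\<exists>R. good G H F R \<and> e \<notin> R \<and> e' \<in> R"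
    if e: "e \<in> E" "e' \<in> E" "e \<noteq> e'" "e \<in> {{x, a}, {x, b}}" for e e'
  proof -
    have "E - (E - {e}) = {e}" using e by auto
    then have "good G H E (E - {e})" using e by (intro good_proper_subcopy[OF G H E(1,3)]) auto
    then obtain R where "good G H F R" "R \<inter> E = E - {e}" using F(4)[of "E - {e}"] e by blast
    then show ?thesis using e by blast
  qed
  show ?thesis
  proof (rule that[of F x a b])
    show "\<forall>R. good G H F R \<longrightarrow> {x, a} \<notin> R \<or> {x, b} \<notin> R"
    proof (intro allI impI, rule ccontr)
      fix R assume R: "good G H F R"
      assume "\<not> ({x, a} \<notin> R \<or> {x, b} \<notin> R)"
      then have "E \<subseteq> R" using F(3)[OF R] by blast
      then show False using emb_mono[OF E(2)] R by (auto simp: good_def)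
    qed
  qed (use F xab ext[of "{x, a}" "{x, b}"] ext[of "{x, b}" "{x, a}"] neq in auto)
qed

text \<open>One gadget forbids two red spokes, and its mirror image with \<open>G\<close> and
  \<open>H\<close> exchanged forbids two blue ones. Joined at \<open>x\<close>, they exclude a
  monochromatic star.\<close>

lemma star_gadget_if_determined:
  assumes G: "conn3 G" and H: "conn3 H" and det: "determined G H D d" "determined H G D' d'"
  shows "\<exists>E x L. star_gadget G H E x L"
proof -
  obtain A :: "nat set set" and x a b where A: "simple_edges A" "{x, a} \<in> A" "{x, b} \<in> A"
    and A_not: "\<forall>R. good G H A R \<longrightarrow> {x, a} \<notin> R \<or> {x, b} \<notin> R"
    and A_ex: "\<exists>R. good G H A R \<and> {x, a} \<in> R \<and> {x, b} \<notin> R"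
      "\<exists>R. good G H A R \<and> {x, a} \<notin> R \<and> {x, b} \<in> R"
    by (rule two_edge_gadget[OF G H det(1)])
  obtain B0 :: "nat set set" and y c0 d0 where B0: "simple_edges B0" "{y, c0} \<in> B0" "{y, d0} \<in> B0"
    and B0_not: "\<forall>R. good H G B0 R \<longrightarrow> {y, c0} \<notin> R \<or> {y, d0} \<notin> R"
    and B0_ex: "\<exists>R. good H G B0 R \<and> {y, c0} \<in> R \<and> {y, d0} \<notin> R"
      "\<exists>R. good H G B0 R \<and> {y, c0} \<notin> R \<and> {y, d0} \<in> R"
    by (rule two_edge_gadget[OF H G det(2)])
  have "inj_on (\<lambda>_. x) {y}" "(\<lambda>_. x) ` {y} \<subseteq> \<Union>A" using A by auto
  then obtain \<phi> where \<phi>: "inj \<phi>" "\<And>v. v \<in> {y} \<Longrightarrow> \<phi> v = x" "\<And>v. v \<notin> {y} \<Longrightarrow> \<phi> v \<notin> \<Union>A"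
    by (rule fresh_relabelling[OF simple_edges_finite_Union[OF A(1)]]) blast
  let ?B = "(`) \<phi> ` B0" and ?c = "\<phi> c0" and ?d = "\<phi> d0"
  have \<phi>y: "\<phi> ` {y, v} = {x, \<phi> v}" for v using \<phi>(2) by simp
  have B: "simple_edges ?B" "{x, ?c} \<in> ?B" "{x, ?d} \<in> ?B"
    using simple_edges_image[OF B0(1) \<phi>(1)] imageI[OF B0(2), of "(`) \<phi>"] imageI[OF B0(3), of "(`) \<phi>"]
    by (simp_all add: \<phi>(2))
  have B_not: "{x, ?c} \<in> R \<or> {x, ?d} \<in> R" if R: "good G H ?B R" for R
  proof -
    let ?R = "{e \<in> B0. \<phi> ` e \<in> R}"
    have "good G H B0 ?R" by (rule good_pullback[OF G H \<phi>(1) R])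
    then have "good H G B0 (B0 - ?R)" by (subst good_swap) auto
    then have "{y, c0} \<notin> B0 - ?R \<or> {y, d0} \<notin> B0 - ?R" using B0_not by blast
    then show ?thesis using B0 by (auto simp: \<phi>(2))
  qed
  have push: "good G H ?B ((`) \<phi> ` (B0 - R))" if "good H G B0 R" for R
  proof -
    have "good G H B0 (B0 - R)" using that good_swap by (metis good_def)
    then show ?thesis by (subst good_inj_image[OF G H \<phi>(1)]) auto
  qed
  have mem: "{x, \<phi> v} \<in> (`) \<phi> ` S \<longleftrightarrow> {y, v} \<in> S" for v S
  proof -
    have "inj ((`) \<phi>)" using \<phi>(1) by (auto simp: inj_def inj_image_eq_iff)
    then show ?thesis unfolding \<phi>y[symmetric] by (rule inj_image_mem_iff)
  qed
  have B_ex: "\<exists>R. good G H ?B R \<and> {x, ?c} \<in> R \<and> {x, ?d} \<notin> R"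
    "\<exists>R. good G H ?B R \<and> {x, ?c} \<notin> R \<and> {x, ?d} \<in> R"
    using B0_ex push B0 mem by (metis Diff_iff)+
  \<comment> \<open>Only the vertex \<open>x\<close> is shared; it is written as a pair to fit
    \<open>good_glue\<close>.\<close>
  have sep: "\<Union>A \<inter> \<Union>?B \<subseteq> {x, x}"
  proof
    fix w assume w: "w \<in> \<Union>A \<inter> \<Union>?B"
    then obtain v where v: "w = \<phi> v" by blast
    then have "v \<in> {y}" using \<phi>(3) w by blast
    then show "w \<in> {x, x}" using \<phi>(2)[of v] v by auto
  qed
  have glue: "\<exists>R. good G H (A \<union> ?B) R \<and> R \<inter> A = RA \<and> R \<inter> ?B = RB"
    if "good G H A RA" "good G H ?B RB" for RA RB
    using good_glue[OF G H that A(1) B(1) sep] simple_edges_loop A(1) B(1) by (metis insert_absorb2)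
  let ?L = "{a, b, ?c, ?d}"
  have "star_gadget G H (A \<union> ?B) x ?L"
    unfolding star_gadget_def
  proof (intro conjI allI impI)
    show "simple_edges (A \<union> ?B)" using simple_edges_Un A B by blast
    show "\<forall>l\<in>?L. {x, l} \<in> A \<union> ?B" using A B by auto
    show "\<exists>R. good G H (A \<union> ?B) R" using A_ex(1) B_ex(1) glue by metis
    obtain RA1 RA2 RB1 RB2 where
      RA: "good G H A RA1" "{x, a} \<in> RA1" "{x, b} \<notin> RA1" "good G H A RA2" "{x, a} \<notin> RA2" "{x, b} \<in> RA2" and
      RB: "good G H ?B RB1" "{x, ?c} \<in> RB1" "{x, ?d} \<notin> RB1" "good G H ?B RB2" "{x, ?c} \<notin> RB2" "{x, ?d} \<in> RB2"
      using A_ex B_ex by metis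
    \<comment> \<open>\<open>R1\<close> and \<open>R2\<close> are opposite on all four spokes, so
      together they show both colours for each.\<close>
    obtain R1 R2 where
      R1: "good G H (A \<union> ?B) R1" "R1 \<inter> A = RA1" "R1 \<inter> ?B = RB1" and
      R2: "good G H (A \<union> ?B) R2" "R2 \<inter> A = RA2" "R2 \<inter> ?B = RB2"
      using glue RA(1,4) RB(1,4) by metis
    have "{x, a} \<in> R1" "{x, b} \<notin> R1" "{x, ?c} \<in> R1" "{x, ?d} \<notin> R1"
      "{x, a} \<notin> R2" "{x, b} \<in> R2" "{x, ?c} \<notin> R2" "{x, ?d} \<in> R2"
      using R1(2,3) R2(2,3) RA RB A B by (metis IntI IntD1)+
    then show "\<forall>l\<in>?L. (\<exists>R. good G H (A \<union> ?B) R \<and> {x, l} \<in> R) \<and> (\<exists>R. good G H (A \<union> ?B) R \<and> {x, l} \<notin> R)"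
      using R1(1) R2(1) by auto
    fix R assume R: "good G H (A \<union> ?B) R"
    show "\<exists>l\<in>?L. {x, l} \<in> R" using B_not[OF good_restrict[OF R, of ?B]] by auto
    show "\<exists>l\<in>?L. {x, l} \<notin> R" using A_not[rule_format, OF good_restrict[OF R, of A]] A by auto
  qed
  then show ?thesis by blast
qed

theorem star_gadget_exists:
  assumes "conn3 G" "conn3 H"
  obtains E x L where "star_gadget G H E x L"
  using star_gadget_if_undetermined[OF assms] star_gadget_if_determined[OF assms]
    determined_swap[OF assms] determined_swap[OF assms(2,1)]
  by metis

section \<open>Gluing star gadgets along a sparse hypergraph\<close>

lemma cyclic_switch:
  assumes "i < m" "P i" "j < m" "\<not> P j"
  shows "\<exists>k<m. P k \<and> \<not> P (Suc k mod m)"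
proof (rule ccontr)
  assume "\<not> ?thesis"
  then have step: "P (Suc k mod m)" if "k < m" "P k" for k using that by blast
  have "P ((i + d) mod m)" for d
  proof (induction d)
    case (Suc d)
    then have "P (Suc ((i + d) mod m) mod m)" using step assms(1) by simp
    then show ?case by (simp add: mod_Suc_eq)
  qed (use assms in simp)
  \<comment> \<open>This offset leads from \<open>i\<close> to \<open>j\<close> modulo
    \<open>m\<close>; the summand \<open>m\<close> keeps the subtraction from truncating.\<close>
  from this[of "m + j - i"] show False using assms by simp
qed

text \<open>If the walk returns to a vertex of the path, the path is cut off there. The bound on
  \<open>set p\<close> carries a property of the ends of steps, such as avoiding a vertex, over to
  every vertex but the start.\<close>

lemma rtrancl_distinct_path:
  assumes "(y, z) \<in> {(u, v). Q u v}\<^sup>*"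
  shows "\<exists>p. p \<noteq> [] \<and> distinct p \<and> hd p = y \<and> last p = z \<and> successively Q p \<and>
    set p \<subseteq> insert y {v. \<exists>u. Q u v}"
  using assms
proof (induction rule: rtrancl_induct)
  case base
  show ?case by (intro exI[of _ "[y]"]) simp
next
  case (step u v)
  then obtain p where p: "p \<noteq> []" "distinct p" "hd p = y" "last p = u" "successively Q p"
    "set p \<subseteq> insert y {v. \<exists>u. Q u v}" and uv: "Q u v" by auto
  show ?case
  proof (cases "v \<in> set p")
    case True
    then obtain as bs where "p = as @ v # bs" by (metis split_list)
    moreover from this have "successively Q ((as @ [v]) @ bs)" using p(5) by simp
    then have "successively Q (as @ [v])" by (simp only: successively_append_iff)
    ultimately show ?thesis using p
      by (intro exI[of _ "as @ [v]"]) (cases as; auto)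
  next
    case False
    then show ?thesis using p uv
      by (intro exI[of _ "p @ [v]"]) (auto simp: successively_append_iff)
  qed
qed

text \<open>Vertex \<open>0\<close> is the centre common to all copies, \<open>\<delta> z\<close> is
  where the copies for hyperedges through \<open>z\<close> meet, and every other vertex is private
  to one copy. The bound on \<open>n\<close> makes the forest property applicable to pairs of
  hyperedges.\<close>

locale glued_stars =
  fixes G :: "'a graph" and H :: "'b graph" and E :: "nat set set" and x :: nat and L :: "nat set"
    and \<H> :: "nat set set" and n :: nat and \<psi> :: "nat set \<Rightarrow> nat \<Rightarrow> nat" and \<delta> :: "nat \<Rightarrow> nat"
  assumes G: "conn3 G" and H: "conn3 H" and gadget: "star_gadget G H E x L"
    and hyp: "uniform (card L) \<H>" "locally_forest n \<H>" "\<And>c. \<exists>h\<in>\<H>. monochromatic c h"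
    and n: "3 \<le> n"
    and inj_\<delta>: "inj \<delta>" and \<delta>_pos: "\<And>z. \<delta> z \<noteq> 0"
    and inj_\<psi>: "\<And>h. h \<in> \<H> \<Longrightarrow> inj (\<psi> h)" and \<psi>_centre: "\<And>h. h \<in> \<H> \<Longrightarrow> \<psi> h x = 0"
    and \<psi>_leaves: "\<And>h. h \<in> \<H> \<Longrightarrow> \<psi> h ` L = \<delta> ` h"
    and \<psi>_\<delta>: "\<And>h v. h \<in> \<H> \<Longrightarrow> \<psi> h v \<in> range \<delta> \<Longrightarrow> v \<in> L"
    and \<psi>_disj: "\<And>h h' v v'. h \<in> \<H> \<Longrightarrow> h' \<in> \<H> \<Longrightarrow> h \<noteq> h' \<Longrightarrow> \<psi> h v = \<psi> h' v' \<Longrightarrow> \<psi> h v \<noteq> 0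
      \<Longrightarrow> v \<in> L \<and> v' \<in> L"
begin

abbreviation copy :: "nat set \<Rightarrow> nat set set" where
  "copy h \<equiv> (`) (\<psi> h) ` E"

definition W :: "nat set set" where
  "W = (\<Union>h\<in>\<H>. copy h)"

lemma simple_E: "simple_edges E"
  using gadget by (simp add: star_gadget_def)

lemma simple_W: "simple_edges W"
  using hyp(1) simple_edges_image[OF simple_E inj_\<psi>]
  by (fastforce simp: W_def simple_edges_def uniform_def)

lemma edge_W:
  assumes "e \<in> W" "u \<in> e"
  obtains v where "e = {u, v}" "u \<noteq> v"
proof -
  have "card e = 2" using assms simple_W by (auto simp: simple_edges_def)
  then show ?thesis using assms that by (auto simp: card_2_iff insert_commute)
qed

lemma shared_vertex:
  assumes "h \<in> \<H>" "h' \<in> \<H>" "h \<noteq> h'" "e \<in> copy h" "e' \<in> copy h'" "w \<in> e" "w \<in> e'" "w \<noteq> 0"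
  obtains z where "w = \<delta> z" "z \<in> h" "z \<in> h'"
proof -
  obtain v where v: "w = \<psi> h v" using assms(4,6) by auto
  obtain v' where v': "w = \<psi> h' v'" using assms(5,7) by auto
  have "v \<in> L \<and> v' \<in> L" using \<psi>_disj[of h h' v v'] assms(1-3,8) v v' by simp
  then have "w \<in> \<psi> h ` L" "w \<in> \<psi> h' ` L" using v v' by blast+
  then have "w \<in> \<delta> ` h" "w \<in> \<delta> ` h'"
    by (simp_all only: \<psi>_leaves[OF assms(1)] \<psi>_leaves[OF assms(2)])
  then show ?thesis using that inj_\<delta> by (auto simp: inj_eq)
qed

text \<open>In a family of two hyperedges one is a leaf, so they have at most one common vertex
  \<open>z\<close>. A common graph edge avoiding \<open>0\<close> would have both ends at
  \<open>\<delta> z\<close>.\<close>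

lemma copy_unique:
  assumes "h \<in> \<H>" "h' \<in> \<H>" "e \<in> copy h" "e \<in> copy h'" "0 \<notin> e"
  shows "h = h'"
proof (rule ccontr)
  assume neq: "h \<noteq> h'"
  have "{h, h'} \<subseteq> \<H>" "2 \<le> card {h, h'}" "card {h, h'} \<le> n" using assms(1,2) neq n by auto
  then obtain h1 where h1: "h1 \<in> {h, h'}" "leaf {h, h'} h1"
    by (rule locally_forestD[OF hyp(2)])
  have "\<Union>({h, h'} - {h1}) = (if h1 = h then h' else h)" using h1(1) neq by auto
  then obtain z where z: "h \<inter> h' \<subseteq> {z}" using h1 by (auto simp: leaf_def split: if_splits)
  have "e \<in> W" using assms by (auto simp: W_def)
  then have "card e = 2" using simple_W by (auto simp: simple_edges_def)
  then obtain u v where e: "e = {u, v}" "u \<noteq> v" by (auto simp: card_2_iff)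
  have "w = \<delta> z" if w: "w \<in> e" for w
  proof -
    have "w \<noteq> 0" using w assms(5) by metis
    from shared_vertex[OF assms(1,2) neq assms(3,4) w w this]
    obtain z' where "w = \<delta> z'" "z' \<in> h" "z' \<in> h'" by metis
    then show ?thesis using z by blast
  qed
  then show False using e by auto
qed

text \<open>Label each edge of the cycle by the hyperedge of its copy. If there are several labels,
  there are at most \<open>n\<close> of them, and some label \<open>g\<close> is a leaf among them.
  The cycle leaves \<open>g\<close> and comes back to it, both times at the one vertex
  \<open>\<delta> z\<close>; but the vertices of a cycle are distinct.\<close>

lemma short_cycle_in_copy:
  assumes E': "E' \<subseteq> W" and p: "is_cycle (V, E') p" "length p \<le> n" "0 \<notin> set p"
    and i: "i < length p" "{p ! i, p ! (Suc i mod length p)} \<in> copy h" "h \<in> \<H>"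
    and j: "j < length p" "{p ! j, p ! (Suc j mod length p)} \<in> copy h'" "h' \<in> \<H>"
  shows "h = h'"
proof (rule ccontr)
  assume neq: "h \<noteq> h'"
  let ?m = "length p" and ?e = "\<lambda>i. {p ! i, p ! (Suc i mod length p)}"
  have m: "3 \<le> ?m" "distinct p" "\<And>i. i < ?m \<Longrightarrow> ?e i \<in> W"
    using p(1) E' by (auto simp: is_cycle_def)
  have no0: "p ! i \<noteq> 0" if "i < ?m" for i using p(3) that by (metis nth_mem)
  have S: "Suc i mod ?m < ?m" for i using m(1) by (intro mod_less_divisor) linarith
  have e0: "0 \<notin> ?e i" if "i < ?m" for i using no0[OF that] no0[OF S] by auto
  have "\<exists>h. h \<in> \<H> \<and> ?e i \<in> copy h" if "i < ?m" for i using m(3)[OF that] by (auto simp: W_def)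
  then obtain lab where lab: "\<And>i. i < ?m \<Longrightarrow> lab i \<in> \<H> \<and> ?e i \<in> copy (lab i)" by metis
  have lab_eq: "lab k = g" if "k < ?m" "?e k \<in> copy g" "g \<in> \<H>" for k g
    using copy_unique[of "lab k" g "?e k"] lab[OF that(1)] that e0[OF that(1)] by blast
  let ?C = "lab ` {..<?m}"
  have "h \<in> ?C" "h' \<in> ?C" using lab_eq[OF i] lab_eq[OF j] i(1) j(1) by auto
  then have "card {h, h'} \<le> card ?C" by (intro card_mono) auto
  then have C2: "2 \<le> card ?C" using neq by simp
  have "card ?C \<le> card {..<?m}" by (rule card_image_le) simp
  then have Cn: "card ?C \<le> n" using p(2) by simp
  have CH: "?C \<subseteq> \<H>" using lab by auto
  obtain g where g: "g \<in> ?C" "leaf ?C g" by (rule locally_forestD[OF hyp(2) CH C2 Cn])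
  obtain z where z: "g \<inter> \<Union>(?C - {g}) \<subseteq> {z}" using g(2) by (auto simp: leaf_def)
  obtain i0 where i0: "i0 < ?m" "lab i0 = g" using g(1) by auto
  obtain j0 where j0: "j0 < ?m" "lab j0 \<noteq> g"
    using lab_eq[OF i] lab_eq[OF j] i(1) j(1) neq by metis
  have turn: "p ! (Suc k mod ?m) = \<delta> z"
    if k: "k < ?m" "(lab k = g) \<noteq> (lab (Suc k mod ?m) = g)" for k
  proof -
    let ?k = "Suc k mod ?m"
    have neqk: "lab k \<noteq> lab ?k" using k(2) by auto
    have "p ! ?k \<in> ?e k" "p ! ?k \<in> ?e ?k" by auto
    from shared_vertex[OF _ _ neqk _ _ this no0[OF S]]
    obtain z' where z': "p ! ?k = \<delta> z'" "z' \<in> lab k" "z' \<in> lab ?k"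
      using lab[OF k(1)] lab[OF S] by metis
    have "lab k \<in> ?C" "lab ?k \<in> ?C" using k(1) S by auto
    then have "z' \<in> g \<inter> \<Union>(?C - {g})" using z'(2,3) k(2) by blast
    then show ?thesis using z z'(1) by blast
  qed
  obtain k where k: "k < ?m" "lab k = g" "lab (Suc k mod ?m) \<noteq> g"
    using cyclic_switch[of i0 ?m "\<lambda>i. lab i = g" j0] i0 j0 by auto
  obtain l where l: "l < ?m" "lab l \<noteq> g" "lab (Suc l mod ?m) = g"
    using cyclic_switch[of j0 ?m "\<lambda>i. lab i \<noteq> g" i0] i0 j0 by auto
  have "p ! (Suc k mod ?m) = p ! (Suc l mod ?m)" using turn k l by simp
  then have "Suc k mod ?m = Suc l mod ?m" using m(2) S by (simp add: nth_eq_iff_index_eq)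
  then show False using k(3) l(3) by simp
qed

section \<open>Colouring subgraphs without long cycles\<close>

definition avoid :: "nat set set \<Rightarrow> nat \<Rightarrow> (nat \<times> nat) set" where
  "avoid D w = {(u, v). {u, v} \<in> D \<and> u \<notin> {0, w} \<and> v \<notin> {0, w}}"

text \<open>The path from \<open>y\<close> to \<open>z\<close> is closed at \<open>w\<close> to a
  cycle avoiding \<open>0\<close>; being short, it stays in a single copy.\<close>

lemma same_copy_if_reachable:
  assumes D: "D \<subseteq> W" and no_cycle: "\<And>p. is_cycle (\<Union>D, D) p \<Longrightarrow> length p < n"
    and wy: "{w, y} \<in> D" "{w, y} \<in> copy h" "h \<in> \<H>" and wz: "{w, z} \<in> D" "{w, z} \<in> copy h'" "h' \<in> \<H>"
    and non0: "w \<noteq> 0" "y \<noteq> 0" "z \<noteq> 0" and path: "(y, z) \<in> (avoid D w)\<^sup>*"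
  shows "h = h'"
proof (cases "y = z")
  case True
  then show ?thesis using copy_unique[of h h' "{w, y}"] wy wz non0 by auto
next
  case False
  have "w \<noteq> y" using wy(1) D simple_edges_loop[OF simple_W, of w] by auto
  let ?Q = "\<lambda>u v. {u, v} \<in> D \<and> u \<notin> {0, w} \<and> v \<notin> {0, w}"
  obtain p where p: "p \<noteq> []" "distinct p" "hd p = y" "last p = z" "successively ?Q p"
    "set p \<subseteq> insert y {v. \<exists>u. ?Q u v}"
    using rtrancl_distinct_path[of y z ?Q] path unfolding avoid_def by blast
  have wp: "w \<notin> set p" "0 \<notin> set p" using p(6) non0 \<open>w \<noteq> y\<close> by auto
  have len: "2 \<le> length p"
  proof (rule ccontr)
    assume "\<not> ?thesis"
    then obtain a where "p = [a]" using p(1) by (cases p; cases "tl p") auto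
    then show False using p(3,4) False by simp
  qed
  let ?c = "w # p"
  have last: "?c ! length p = z" using p(1,4) by (simp add: last_conv_nth nth_Cons')
  have first: "?c ! Suc 0 = y" using p(1,3) by (simp add: hd_conv_nth)
  have edge: "{?c ! i, ?c ! (Suc i mod length ?c)} \<in> D" if i: "i < length ?c" for i
  proof -
    consider "i = 0" | "i = length p" "i \<noteq> 0" | k where "i = Suc k" "Suc k < length p"
      using i by (cases i) fastforce+
    then show ?thesis
    proof cases
      case 1
      then show ?thesis using len first wy(1) by (cases p) auto
    next
      case 2
      then show ?thesis using last wz(1) by (simp add: insert_commute)
    next
      case 3
      then show ?thesis using p(5) by (simp add: successively_conv_nth)
    qed
  qed
  have mem: "?c ! i \<in> \<Union>D" if "i < length ?c" for i using edge[OF that] by blast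
  have "set ?c \<subseteq> \<Union>D"
  proof
    fix v assume "v \<in> set ?c"
    then obtain i where "i < length ?c" "?c ! i = v" by (metis in_set_conv_nth)
    then show "v \<in> \<Union>D" using mem by metis
  qed
  then have cyc: "is_cycle (\<Union>D, D) ?c"
    using len p(2) wp(1) edge by (auto simp: is_cycle_def simp del: nth_Cons_Suc)
  have "length ?c \<le> n" using no_cycle[OF cyc] by simp
  moreover have "0 \<notin> set ?c" using wp non0 by simp
  moreover have "{?c ! 0, ?c ! (Suc 0 mod length ?c)} \<in> copy h"
    using len first wy(2) by (cases p) auto
  moreover have "{?c ! length p, ?c ! (Suc (length p) mod length ?c)} \<in> copy h'"
    using last wz(2) by (simp add: insert_commute)
  ultimately show ?thesis
    using short_cycle_in_copy[OF D cyc, of 0 h "length p" h'] wy(3) wz(3) by simp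
qed

text \<open>Prescribing the colour of one spoke is what carries the induction across a cut with
  adjacent vertices. The value \<open>t = 0\<close> stands for no spoke, as \<open>{0}\<close> is
  not an edge, and corresponds to cuts consisting of \<open>0\<close> alone.\<close>

definition flexible :: "nat set set \<Rightarrow> bool" where
  "flexible D \<longleftrightarrow> (\<forall>t\<in>insert 0 (range \<delta>). \<forall>b. \<exists>R. good G H D R \<and> ({0, t} \<in> D \<longrightarrow> ({0, t} \<in> R) = b))"

lemma flexible_copy:
  assumes D: "D \<subseteq> copy h" and h: "h \<in> \<H>"
  shows "flexible D"
  unfolding flexible_def
proof (intro ballI allI)
  fix t b assume t: "t \<in> insert 0 (range \<delta>)"
  have push: "good G H D ((`) (\<psi> h) ` R \<inter> D)" if "good G H E R" for R
  proof -
    have "good G H (copy h) ((`) (\<psi> h) ` R)"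
      using that good_inj_image[OF G H inj_\<psi>[OF h]] by (auto simp: good_def)
    then show ?thesis using good_restrict D by blast
  qed
  show "\<exists>R. good G H D R \<and> ({0, t} \<in> D \<longrightarrow> ({0, t} \<in> R) = b)"
  proof (cases "{0, t} \<in> D")
    case False
    then show ?thesis using gadget push by (auto simp: star_gadget_def)
  next
    case True
    then obtain e where e: "e \<in> E" "\<psi> h ` e = {0, t}" using D by auto
    have "{0, t} \<in> W" using True D h by (auto simp: W_def)
    then have "t \<noteq> 0" using simple_edges_loop[OF simple_W, of 0] by (metis insert_absorb2)
    obtain l where l: "l \<in> e" "\<psi> h l = t" using e(2) by (metis imageE insertI1 insert_commute)
    \<comment> \<open>A vertex of the form \<open>\<delta> z\<close> comes from \<open>L\<close>, so
      the edge is one of the free spokes of the gadget.\<close>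
    then have "l \<in> L" using \<psi>_\<delta>[OF h, of l] t \<open>t \<noteq> 0\<close> by auto
    then obtain R where R: "good G H E R" "({x, l} \<in> R) = b"
      using gadget unfolding star_gadget_def by (cases b) auto
    have "inj ((`) (\<psi> h))" using inj_\<psi>[OF h] by (auto simp: inj_def inj_image_eq_iff)
    then have "\<psi> h ` {x, l} \<in> (`) (\<psi> h) ` R \<longleftrightarrow> {x, l} \<in> R" by (rule inj_image_mem_iff)
    moreover have "\<psi> h ` {x, l} = {0, t}" using \<psi>_centre[OF h] l by simp
    ultimately have "({0, t} \<in> (`) (\<psi> h) ` R \<inter> D) = b" using True R(2) by simp
    then show ?thesis using push[OF R(1)] by blast
  qed
qed

text \<open>The side containing the prescribed spoke \<open>{0, t}\<close> is coloured first; the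
  freedom of the other side is then spent on the edge \<open>{0, w}\<close> of the cut.\<close>

lemma flexible_glue:
  assumes A: "A \<subseteq> W" "flexible A" and B: "B \<subseteq> W" "flexible B"
    and sep: "\<Union>A \<inter> \<Union>B \<subseteq> {0, w}" and w: "w \<in> insert 0 (range \<delta>)" and edge: "{0, w} \<in> A \<longleftrightarrow> {0, w} \<in> B"
  shows "flexible (A \<union> B)"
  unfolding flexible_def
proof (intro ballI allI)
  fix t b assume t: "t \<in> insert 0 (range \<delta>)"
  have simple: "simple_edges A" "simple_edges B" using A B simple_edges_subset simple_W by blast+
  have "\<exists>RA RB. good G H A RA \<and> good G H B RB \<and> ({0, w} \<in> A \<longrightarrow> ({0, w} \<in> RA \<longleftrightarrow> {0, w} \<in> RB)) \<and>
      ({0, t} \<in> A \<longrightarrow> ({0, t} \<in> RA) = b) \<and> ({0, t} \<notin> A \<and> {0, t} \<in> B \<longrightarrow> ({0, t} \<in> RB) = b)"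
  proof (cases "{0, t} \<in> A")
    case True
    then obtain RA where RA: "good G H A RA" "({0, t} \<in> RA) = b" using A(2) t by (metis flexible_def)
    obtain RB where "good G H B RB" "{0, w} \<in> B \<longrightarrow> ({0, w} \<in> RB) = ({0, w} \<in> RA)"
      using B(2) w unfolding flexible_def by meson
    then show ?thesis using RA True edge by blast
  next
    case False
    obtain RB where RB: "good G H B RB" "{0, t} \<in> B \<longrightarrow> ({0, t} \<in> RB) = b"
      using B(2) t by (metis flexible_def)
    obtain RA where "good G H A RA" "{0, w} \<in> A \<longrightarrow> ({0, w} \<in> RA) = ({0, w} \<in> RB)"
      using A(2) w unfolding flexible_def by meson
    then show ?thesis using RB False by blast
  qed
  then obtain RA RB where R: "good G H A RA" "good G H B RB" "{0, w} \<in> A \<longrightarrow> ({0, w} \<in> RA \<longleftrightarrow> {0, w} \<in> RB)"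
    "{0, t} \<in> A \<longrightarrow> ({0, t} \<in> RA) = b" "{0, t} \<notin> A \<and> {0, t} \<in> B \<longrightarrow> ({0, t} \<in> RB) = b"
    by blast
  have uv: "{0, w} \<in> A \<Longrightarrow> {0, w} \<in> B \<and> ({0, w} \<in> RA \<longleftrightarrow> {0, w} \<in> RB)" "{0, w} \<in> B \<Longrightarrow> {0, w} \<in> A"
    using R(3) edge by auto
  note glue = good_glue[OF G H R(1,2) simple sep uv]
  have "({0, t} \<in> RA \<union> RB) = b" if "{0, t} \<in> A \<union> B"
  proof (cases "{0, t} \<in> A")
    case True
    then have "{0, t} \<in> RA \<union> RB \<longleftrightarrow> {0, t} \<in> RA" using glue(2) by blast
    then show ?thesis using R(4) True by blast
  next
    case False
    then have "{0, t} \<in> B" using that by blast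
    then have "{0, t} \<in> RA \<union> RB \<longleftrightarrow> {0, t} \<in> RB" using glue(3) by blast
    then show ?thesis using R(5) False \<open>{0, t} \<in> B\<close> by blast
  qed
  then show "\<exists>R. good G H (A \<union> B) R \<and> ({0, t} \<in> A \<union> B \<longrightarrow> ({0, t} \<in> R) = b)"
    using glue(1) by blast
qed

text \<open>By \<open>conn\<close>, no cut \<open>{0, w}\<close> separates \<open>D\<close>. If two
  edges off \<open>0\<close> meet at a shared vertex \<open>w\<close>, their other ends are joined
  off the cut, which puts both edges in one copy; connectedness after deleting \<open>0\<close>
  spreads this to all edges off \<open>0\<close>. An edge at \<open>0\<close> may come from another
  copy, but then its outer end is shared, and the edge is also a spoke of copy
  \<open>h0\<close>.\<close>

lemma in_one_copy:
  assumes D: "D \<subseteq> W" and no_cycle: "\<And>p. is_cycle (\<Union>D, D) p \<Longrightarrow> length p < n"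
    and conn: "\<And>w y z. w \<in> insert 0 (range \<delta>) \<Longrightarrow> y \<in> \<Union>D - {0, w} \<Longrightarrow> z \<in> \<Union>D - {0, w} \<Longrightarrow>
      (y, z) \<in> (avoid D w)\<^sup>*"
  obtains h where "h \<in> \<H>" "D \<subseteq> copy h"
proof (cases "\<exists>e\<in>D. 0 \<notin> e")
  case False
  obtain h0 where h0: "h0 \<in> \<H>" using hyp(3) by blast
  \<comment> \<open>All edges contain \<open>0\<close>, so deleting it leaves no edge; connectedness
    then admits only one further vertex, hence at most one edge.\<close>
  have "avoid D 0 = {}" using False by (auto simp: avoid_def)
  then have eq: "y = z" if "y \<in> \<Union>D - {0}" "z \<in> \<Union>D - {0}" for y z
    using conn[of 0 y z] that by simp
  have star: "\<exists>u. e = {0, u} \<and> u \<noteq> 0" if "e \<in> D" for e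
  proof -
    have "e \<in> W" "0 \<in> e" using that D False by auto
    then show ?thesis by (rule edge_W) auto
  qed
  show ?thesis
  proof (cases "D = {}")
    case True
    then show ?thesis using that h0 by blast
  next
    case nonempty: False
    then obtain e where e: "e \<in> D" by blast
    have "e' = e" if e': "e' \<in> D" for e'
    proof -
      obtain u where u: "e = {0, u}" "u \<noteq> 0" using star[OF e] by auto
      obtain v where v: "e' = {0, v}" "v \<noteq> 0" using star[OF e'] by auto
      have "u = v" using eq u v e e' by blast
      then show ?thesis using u v by simp
    qed
    then have "D = {e}" using e by blast
    moreover obtain h where "h \<in> \<H>" "e \<in> copy h" using e D by (auto simp: W_def)
    ultimately show ?thesis using that by blast
  qed
next
  case True
  then obtain e0 where e0: "e0 \<in> D" "0 \<notin> e0" by blast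
  obtain h0 where h0: "h0 \<in> \<H>" "e0 \<in> copy h0" using e0 D by (auto simp: W_def)
  have "card e0 = 2" using e0 D simple_W by (auto simp: simple_edges_def)
  then obtain y0 y1 where y01: "e0 = {y0, y1}" "y0 \<noteq> y1" by (auto simp: card_2_iff)
  have local: "h = h'"
    if e: "e \<in> D" "e \<in> copy h" "h \<in> \<H>" "0 \<notin> e" and e': "e' \<in> D" "e' \<in> copy h'" "h' \<in> \<H>" "0 \<notin> e'"
      and w: "w \<in> e" "w \<in> e'" for e e' h h' w
  proof (rule ccontr)
    assume neq: "h \<noteq> h'"
    have w0: "w \<noteq> 0" using w e by metis
    obtain z where z: "w = \<delta> z"
      by (rule shared_vertex[OF e(3) e'(3) neq e(2) e'(2) w w0])
    obtain a where a: "e = {w, a}" "w \<noteq> a" using edge_W[of e w] e w D by blast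
    obtain b where b: "e' = {w, b}" "w \<noteq> b" using edge_W[of e' w] e' w D by blast
    have "a \<in> \<Union>D - {0, w}" "b \<in> \<Union>D - {0, w}" using a b e e' by auto
    then have "(a, b) \<in> (avoid D w)\<^sup>*" using conn[of w a b] z by blast
    then show False
      using same_copy_if_reachable[OF D no_cycle, of w a h b h'] a b e e' w0 neq by auto
  qed
  have all: "e \<in> copy h0" if "(y0, v) \<in> (avoid D 0)\<^sup>*" "e \<in> D" "v \<in> e" "0 \<notin> e" for v e
    using that
  proof (induction arbitrary: e rule: rtrancl_induct)
    case base
    obtain h where "h \<in> \<H>" "e \<in> copy h" using base D by (auto simp: W_def)
    then show ?case using local[of e h e0 h0 y0] base e0 h0 y01 by auto
  next
    case (step u v)
    then have uv: "{u, v} \<in> D" "0 \<notin> {u, v}" by (auto simp: avoid_def)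
    then have "{u, v} \<in> copy h0" using step.IH by simp
    moreover obtain h where "h \<in> \<H>" "e \<in> copy h" using step.prems D by (auto simp: W_def)
    ultimately show ?case using local[of e h "{u, v}" h0 v] step.prems uv h0 by auto
  qed
  have y0D: "y0 \<in> \<Union>D - {0, 0}" using e0 y01 by auto
  have "e \<in> copy h0" if e: "e \<in> D" for e
  proof (cases "0 \<in> e")
    case False
    have "card e = 2" using e D simple_W by (auto simp: simple_edges_def)
    then have "e \<noteq> {}" by auto
    then obtain v where v: "v \<in> e" by blast
    then have "v \<in> \<Union>D - {0, 0}" using e False by (metis DiffI UnionI insert_iff empty_iff)
    then show ?thesis using all[OF conn[OF _ y0D]] e v False by blast
  next
    case True
    then obtain v where v: "e = {0, v}" "0 \<noteq> v" using edge_W[of e 0] e D by blast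
    then have reach: "(y0, v) \<in> (avoid D 0)\<^sup>*" using conn[OF _ y0D, of v] e by auto
    have "\<exists>e1\<in>D. v \<in> e1 \<and> 0 \<notin> e1"
    proof (cases "v = y0")
      case True
      then show ?thesis using e0 y01 by blast
    next
      case False
      then obtain u where "(u, v) \<in> avoid D 0" using reach by (metis rtranclE)
      then show ?thesis by (intro bexI[of _ "{u, v}"]) (auto simp: avoid_def)
    qed
    then obtain e1 where e1: "e1 \<in> D" "v \<in> e1" "0 \<notin> e1" by blast
    then have e1c: "e1 \<in> copy h0" using all[OF reach] by blast
    obtain h where h: "h \<in> \<H>" "e \<in> copy h" using e D by (auto simp: W_def)
    show ?thesis
    proof (cases "h = h0")
      case False
      have "v \<in> e" using v by simp
      from shared_vertex[OF h(1) h0(1) False h(2) e1c this e1(2) v(2)[symmetric]]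
      obtain z where z: "v = \<delta> z" "z \<in> h0" by metis
      then have "v \<in> \<psi> h0 ` L" using \<psi>_leaves[OF h0(1)] by simp
      then obtain l where l: "l \<in> L" "v = \<psi> h0 l" by blast
      then have "e = \<psi> h0 ` {x, l}" using v \<psi>_centre[OF h0(1)] by simp
      moreover have "{x, l} \<in> E" using l gadget by (auto simp: star_gadget_def)
      ultimately show ?thesis by (rule image_eqI)
    qed (use h in simp)
  qed
  then show ?thesis using h0(1) by (intro that[of h0] subsetI)
qed

lemma flexible_if_short_cycles:
  assumes "D \<subseteq> W" "\<And>p. is_cycle (\<Union>D, D) p \<Longrightarrow> length p < n"
  shows "flexible D"
proof -
  have "finite D" using assms(1) simple_W by (auto simp: simple_edges_def intro: finite_subset)
  then show ?thesis using assms
  proof (induction D rule: finite_psubset_induct)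
    case (psubset D)
    note DW = psubset.prems(1) and no_cycle = psubset.prems(2)
    have IH: "flexible A" if A: "A \<subset> D" for A
    proof (rule psubset.IH[OF A])
      show "A \<subseteq> W" using A DW by blast
      fix p assume "is_cycle (\<Union>A, A) p"
      moreover have "\<Union>A \<subseteq> \<Union>D" using A by blast
      ultimately have "is_cycle (\<Union>D, D) p" using A unfolding is_cycle_def by auto
      then show "length p < n" by (rule no_cycle)
    qed
    show ?case
    proof (cases "\<forall>w\<in>insert 0 (range \<delta>). \<forall>y\<in>\<Union>D - {0, w}. \<forall>z\<in>\<Union>D - {0, w}. (y, z) \<in> (avoid D w)\<^sup>*")
      case True
      then obtain h where "h \<in> \<H>" "D \<subseteq> copy h"
        using in_one_copy[OF DW no_cycle] by metis
      then show ?thesis using flexible_copy by blast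
    next
      case False
      then obtain w y z where w: "w \<in> insert 0 (range \<delta>)" and y: "y \<in> \<Union>D - {0, w}"
        and z: "z \<in> \<Union>D - {0, w}" and yz: "(y, z) \<notin> (avoid D w)\<^sup>*" by blast
      define K where "K = {v. (y, v) \<in> (avoid D w)\<^sup>*}"
      \<comment> \<open>\<open>K\<close> is the component of \<open>y\<close> off the cut. The edge
        \<open>{0, w}\<close> misses \<open>K\<close> and so falls into \<open>B\<close>; it is
        added to \<open>A\<close> because \<open>flexible_glue\<close> wants it on both sides or on
        neither. Both sides are proper: \<open>A\<close> misses \<open>z\<close> and
        \<open>B\<close> misses \<open>y\<close>.\<close>
      define A where "A = {e \<in> D. e \<inter> K \<noteq> {}} \<union> (D \<inter> {{0, w}})"
      define B where "B = {e \<in> D. e \<inter> K = {}}"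
      have K: "0 \<notin> K" "w \<notin> K"
        using y by (auto simp: K_def avoid_def elim: rtranclE)
      have closed: "e \<subseteq> K \<union> {0, w}" if e: "e \<in> D" "e \<inter> K \<noteq> {}" for e
      proof -
        obtain u where u: "u \<in> e" "u \<in> K" using e(2) by blast
        obtain v where v: "e = {u, v}" using edge_W[of e u] u e DW by blast
        have "v \<in> K" if "v \<notin> {0, w}"
        proof -
          have "(u, v) \<in> avoid D w" using that v e u K by (auto simp: avoid_def)
          then show ?thesis using u(2) by (auto simp: K_def intro: rtrancl_into_rtrancl)
        qed
        then show ?thesis using u v by blast
      qed
      have AB: "A \<union> B = D" by (auto simp: A_def B_def)
      have "\<Union>A \<subseteq> K \<union> {0, w}" using closed by (auto simp: A_def)
      moreover have "\<Union>B \<inter> K = {}" by (auto simp: B_def)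
      ultimately have sep: "\<Union>A \<inter> \<Union>B \<subseteq> {0, w}" by blast
      have edge: "{0, w} \<in> A \<longleftrightarrow> {0, w} \<in> B" using K by (auto simp: A_def B_def)
      have "z \<notin> \<Union>A" using \<open>\<Union>A \<subseteq> K \<union> {0, w}\<close> z yz by (auto simp: K_def)
      then have "A \<noteq> D" using z by blast
      then have "A \<subset> D" using AB by blast
      moreover have "y \<notin> \<Union>B" using \<open>\<Union>B \<inter> K = {}\<close> by (auto simp: K_def)
      then have "B \<noteq> D" using y by blast
      then have "B \<subset> D" using AB by blast
      ultimately have "flexible (A \<union> B)"
        using DW IH by (intro flexible_glue[OF _ _ _ _ sep w edge]) auto
      then show ?thesis using AB by simp
    qed
  qed
qed

text \<open>Give each hypergraph vertex \<open>z\<close> the colour of the spoke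
  \<open>{0, \<delta> z}\<close>. A monochromatic hyperedge then yields a copy of the gadget with a
  monochromatic star, which no good colouring has.\<close>

lemma W_arrows: "\<not> good G H W R"
proof
  assume R: "good G H W R"
  obtain h where h: "h \<in> \<H>" "monochromatic (\<lambda>z. {0, \<delta> z} \<in> R) h" using hyp(3) by blast
  then obtain b where b: "\<And>z. z \<in> h \<Longrightarrow> ({0, \<delta> z} \<in> R) = b" by (auto simp: monochromatic_def)
  have sub: "copy h \<subseteq> W" using h by (auto simp: W_def)
  let ?R = "{e \<in> E. \<psi> h ` e \<in> R \<inter> copy h}"
  have good: "good G H E ?R"
    by (rule good_pullback[OF G H inj_\<psi>[OF h(1)] good_restrict[OF R sub]])
  have "({x, l} \<in> ?R) = b" if l: "l \<in> L" for l
  proof -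
    have E: "{x, l} \<in> E" using l gadget by (auto simp: star_gadget_def)
    obtain z where z: "z \<in> h" "\<psi> h l = \<delta> z" using \<psi>_leaves[OF h(1)] l by blast
    have im: "\<psi> h ` {x, l} = {0, \<delta> z}" using z \<psi>_centre[OF h(1)] by simp
    then have "{0, \<delta> z} \<in> copy h" using E by (metis imageI)
    then show ?thesis using E im b[OF z(1)] by simp
  qed
  then show False using gadget good unfolding star_gadget_def by blast
qed

end

section \<open>Back to subgraphs and isomorphisms\<close>

lemma mono_copy_iff_emb:
  assumes F: "sgraph F" and G: "conn3 G" and C: "C \<subseteq> edges F"
  shows "(\<exists>S. subgraph S F \<and> isomorphic S G \<and> edges S \<subseteq> C) \<longleftrightarrow> emb G C"
proof
  assume "\<exists>S. subgraph S F \<and> isomorphic S G \<and> edges S \<subseteq> C"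
  then obtain S f where S: "edges S \<subseteq> C" "bij_betw f (verts S) (verts G)"
    "\<forall>u\<in>verts S. \<forall>v\<in>verts S. {u, v} \<in> edges S \<longleftrightarrow> {f u, f v} \<in> edges G"
    by (auto simp: isomorphic_def)
  let ?g = "inv_into (verts S) f"
  have g: "bij_betw ?g (verts G) (verts S)" using S(2) by (rule bij_betw_inv_into)
  have "?g ` e \<in> C" if e: "e \<in> edges G" for e
  proof -
    obtain p q where pq: "e = {p, q}" "p \<in> verts G" "q \<in> verts G"
      using conn3_edge[OF G e] by (auto simp: card_2_iff)
    moreover then have "?g p \<in> verts S" "?g q \<in> verts S" "f (?g p) = p" "f (?g q) = q"
      using g S(2) by (auto simp: bij_betw_apply bij_betw_inv_into_right)
    ultimately have "{?g p, ?g q} \<in> edges S" using S(3) e by auto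
    then show ?thesis using S(1) pq by auto
  qed
  then show "emb G C" using g by (auto simp: emb_def bij_betw_def)
next
  assume "emb G C"
  then obtain f where f: "inj_on f (verts G)" "\<forall>e\<in>edges G. f ` e \<in> C" by (auto simp: emb_def)
  let ?S = "(f ` verts G, (`) f ` edges G)"
  have sg: "sgraph ?S"
    using conn3_edge[OF G] conn3_finite[OF G] f(1)
    by (auto simp: sgraph_def card_image inj_on_subset)
  \<comment> \<open>Each vertex of \<open>G\<close> lies on an edge, whose image is an edge of
    \<open>F\<close>.\<close>
  have "f p \<in> verts F" if p: "p \<in> verts G" for p
  proof -
    obtain q where "{p, q} \<in> edges G" using conn3_two_neighbours[OF G p] by metis
    then have "f ` {p, q} \<in> edges F" using f(2) C by blast
    then show ?thesis using F by (auto simp: sgraph_def)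
  qed
  then have sub: "subgraph ?S F" using sg f(2) C by (auto simp: subgraph_def)
  have "{f p, f q} \<in> (`) f ` edges G \<longleftrightarrow> {p, q} \<in> edges G" if pq: "p \<in> verts G" "q \<in> verts G" for p q
  proof
    assume "{f p, f q} \<in> (`) f ` edges G"
    then obtain e where e: "e \<in> edges G" "f ` {p, q} = f ` e" by auto
    then have "{p, q} = e" using inj_on_image_eq_iff[OF f(1), of "{p, q}" e] conn3_edge[OF G e(1)] pq by blast
    then show "{p, q} \<in> edges G" using e by simp
  next
    assume "{p, q} \<in> edges G"
    then show "{f p, f q} \<in> (`) f ` edges G" by (metis image_eqI image_empty image_insert)
  qed
  then have "isomorphic ?S G"
    using f(1) unfolding isomorphic_def
    by (intro exI[of _ "inv_into (verts G) f"]) (auto simp: bij_betw_inv_into inj_on_imp_bij_betw)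
  then show "\<exists>S. subgraph S F \<and> isomorphic S G \<and> edges S \<subseteq> C" using sub f(2) by auto
qed

lemma mono_subgraph_iff_emb:
  assumes "sgraph F" "conn3 G"
  shows "(\<exists>S. subgraph S F \<and> isomorphic S G \<and> (\<forall>e\<in>edges S. c e = i)) \<longleftrightarrow>
    emb G {e \<in> edges F. c e = i}"
proof -
  have "(\<exists>S. subgraph S F \<and> isomorphic S G \<and> (\<forall>e\<in>edges S. c e = i)) \<longleftrightarrow>
      (\<exists>S. subgraph S F \<and> isomorphic S G \<and> edges S \<subseteq> {e \<in> edges F. c e = i})"
    by (intro ex_cong1) (auto simp: subgraph_def)
  also have "\<dots> \<longleftrightarrow> emb G {e \<in> edges F. c e = i}"
    by (intro mono_copy_iff_emb[OF assms]) auto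
  finally show ?thesis .
qed

lemma ramsey_arrow_iff:
  assumes F: "sgraph F" and G: "conn3 G" and H: "conn3 H"
  shows "ramsey_arrow F G H \<longleftrightarrow> \<not> (\<exists>R. good G H (edges F) R)"
proof -
  have good_iff: "good_coloring G H F c \<longleftrightarrow> good G H (edges F) {e \<in> edges F. c e = 0}"
    if c: "c \<in> edges F \<rightarrow> {0, 1}" for c
  proof -
    have "edges F - {e \<in> edges F. c e = 0} = {e \<in> edges F. c e = 1}" using c by (force simp: Pi_iff)
    then show ?thesis
      using c mono_subgraph_iff_emb[OF F G, of c 0] mono_subgraph_iff_emb[OF F H, of c 1]
      by (simp add: good_coloring_def good_def)
  qed
  have "\<exists>c. good_coloring G H F c" if R: "good G H (edges F) R" for R
  proof -
    let ?c = "\<lambda>e. if e \<in> R then 0 else 1 :: nat"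
    have "{e \<in> edges F. ?c e = 0} = R" using R by (auto simp: good_def)
    then have "good_coloring G H F ?c" using R good_iff[of ?c] by auto
    then show ?thesis by blast
  qed
  moreover have "\<exists>R. good G H (edges F) R" if "good_coloring G H F c" for c
    using good_iff[of c] that by (auto simp: good_coloring_def)
  ultimately show ?thesis unfolding ramsey_arrow_def by blast
qed

theorem theorem3:
  fixes G :: "'a graph" and H :: "'b graph" and n :: nat
  assumes "G \<in> Gamma3" and "H \<in> Gamma3"
  shows "\<exists>F :: nat graph. F \<in> ramsey_minimal G H \<and> (\<exists>p. is_cycle F p \<and> length p \<ge> n)"
proof -
  have G: "conn3 G" and H: "conn3 H" using assms conn3_if_Gamma3 by blast+
  obtain E x L where gadget: "star_gadget G H E x L" by (rule star_gadget_exists[OF G H])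
  have simpleE: "simple_edges E" and xL: "\<And>l. l \<in> L \<Longrightarrow> {x, l} \<in> E"
    using gadget by (auto simp: star_gadget_def)
  have "x \<notin> L" using xL[of x] simple_edges_loop[OF simpleE, of x] by auto
  have "L \<subseteq> \<Union>E" using xL by blast
  then have "finite L" using simple_edges_finite_Union[OF simpleE] finite_subset by blast
  \<comment> \<open>The maximum with 3 meets the bound demanded by \<open>glued_stars\<close>; a
    subgraph whose cycles are shorter than \<open>n\<close> still qualifies.\<close>
  obtain \<H> :: "nat set set" where \<H>: "uniform (card L) \<H>" "locally_forest (max n 3) \<H>"
    "\<forall>c. \<exists>h\<in>\<H>. monochromatic c h"
    using sparse_chromatic_hypergraph by blast
  obtain \<epsilon> :: "nat \<Rightarrow> nat" and \<phi> :: "nat set \<Rightarrow> nat \<Rightarrow> nat" where \<epsilon>: "inj \<epsilon>"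
    and \<phi>: "\<And>h. h \<in> \<H> \<Longrightarrow> inj (\<phi> h)" "\<And>h. h \<in> \<H> \<Longrightarrow> \<phi> h ` L = \<epsilon> ` h"
    and disj: "\<And>h h' v v'. h \<in> \<H> \<Longrightarrow> h' \<in> \<H> \<Longrightarrow> h \<noteq> h' \<Longrightarrow> \<phi> h v = \<phi> h' v' \<Longrightarrow> v \<in> L \<and> v' \<in> L"
    and \<phi>\<epsilon>: "\<And>h v. h \<in> \<H> \<Longrightarrow> \<phi> h v \<in> range \<epsilon> \<Longrightarrow> v \<in> L"
    by (rule gluing_maps[OF \<H>(1) \<open>finite L\<close>]) blast
  \<comment> \<open>The successor frees \<open>0\<close> for the common centre.\<close>
  define \<psi> where "\<psi> = (\<lambda>h v. if v = x then 0 else Suc (\<phi> h v))"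
  define \<delta> where "\<delta> = (\<lambda>z. Suc (\<epsilon> z))"
  have \<psi>L: "\<psi> h ` L = Suc ` \<phi> h ` L" for h
    using \<open>x \<notin> L\<close> by (auto simp: \<psi>_def image_iff)
  interpret glued_stars G H E x L \<H> "max n 3" \<psi> \<delta>
  proof
    show "inj \<delta>" using \<epsilon> by (simp add: \<delta>_def inj_def)
    show "\<psi> h ` L = \<delta> ` h" if "h \<in> \<H>" for h
      unfolding \<psi>L \<phi>(2)[OF that] by (simp add: \<delta>_def image_image)
    show "inj (\<psi> h)" if "h \<in> \<H>" for h
      by (rule injI) (auto simp: \<psi>_def split: if_splits dest: injD[OF \<phi>(1)[OF that]])
    show "v \<in> L" if "h \<in> \<H>" "\<psi> h v \<in> range \<delta>" for h v
      using \<phi>\<epsilon>[OF that(1), of v] that(2) by (auto simp: \<psi>_def \<delta>_def split: if_splits)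
    show "v \<in> L \<and> v' \<in> L" if "h \<in> \<H>" "h' \<in> \<H>" "h \<noteq> h'" "\<psi> h v = \<psi> h' v'" "\<psi> h v \<noteq> 0" for h h' v v'
      using disj[OF that(1-3), of v v'] that(4,5) by (auto simp: \<psi>_def split: if_splits)
  qed (use G H gadget \<H> in \<open>auto simp: \<psi>_def \<delta>_def\<close>)
  have "finite W" using simple_W by (simp add: simple_edges_def)
  moreover have "\<not> (\<exists>R. good G H W R)" using W_arrows by blast
  ultimately obtain M where M: "M \<subseteq> W" "\<not> (\<exists>R. good G H M R)"
    and M_min: "\<And>D. D \<subset> M \<Longrightarrow> \<exists>R. good G H D R"
    by (rule minimal_arrowing) blast
  have simpleM: "simple_edges M" using simple_edges_subset[OF simple_W M(1)] .
  \<comment> \<open>With \<open>\<Union>M\<close> as vertex set there is no isolated vertex, so a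
    proper subgraph always lacks an edge.\<close>
  let ?F = "(\<Union>M, M)"
  have sgF: "sgraph ?F"
    using simpleM simple_edges_finite_Union[OF simpleM] by (auto simp: sgraph_def simple_edges_def)
  have "\<not> ramsey_arrow F' G H" if F': "subgraph F' ?F" "F' \<noteq> ?F" for F'
  proof -
    have sg: "sgraph F'" "verts F' \<subseteq> \<Union>M" "edges F' \<subseteq> M" using F'(1) by (auto simp: subgraph_def)
    have "edges F' \<noteq> M"
    proof
      assume eq: "edges F' = M"
      then have "\<Union>M \<subseteq> verts F'" using sg(1) by (auto simp: sgraph_def)
      then show False using F'(2) sg(2) eq by (metis prod.collapse subset_antisym)
    qed
    then have "\<exists>R. good G H (edges F') R" using sg(3) by (intro M_min) blast
    then show ?thesis using ramsey_arrow_iff[OF sg(1) G H] by blast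
  qed
  then have "?F \<in> ramsey_minimal G H"
    using sgF M(2) ramsey_arrow_iff[OF sgF G H] by (simp add: ramsey_minimal_def)
  moreover have "\<exists>p. is_cycle ?F p \<and> n \<le> length p"
  proof (rule ccontr)
    assume "\<not> ?thesis"
    then have "flexible M" using M(1) by (intro flexible_if_short_cycles) force+
    then show False using M(2) unfolding flexible_def by blast
  qed
  ultimately show ?thesis by blast
qed

end
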